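(* Let $\kappa>0$, $h>0$. Let $A\ge0$ be a random variable with $\mathbf{E}A^\kappa=\theta\in(0,1)$, such that the distribution of $\log A$ conditioned on $A\ne0$ is arithmetic with span $h$. Let $F_\kappa$ be the (normalized) tilted distribution function of $\log A$ and $p_n=F_\kappa(nh)-F_\kappa(nh-)$, $n\in\mathbb{Z}$. Assume that $F_\kappa$ is $h$-subexponential, $F_\kappa\in\mathcal{S}_h$, and that $\sup_{k\ge n}p_k=O(p_n)$ as $n\to\infty$. Let $X$ be a real random variable independent of $A$ such that for some $\delta>0$ $$\int_0^\infty y^{\kappa+\delta-1}\,\big|\mathbf{P}\{X>y\}-\mathbf{P}\{AX>y\}\big|\,\mathrm{d}y<\infty .$$ Then there exists a function $q\in\mathcal{Q}_{\kappa,h}$ such that $$\lim_{n\to\infty}p_n^{-1}\,x^\kappa e^{\kappa nh}\,\mathbf{P}\{X>xe^{nh}\}=q(x),\qquad x\in C_q .$$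
   Context: A random variable $Y$ (or its distribution) is arithmetic if $Y\in h\mathbb{Z}$ a.s. for some $h>0$; the largest such $h$ is the span of $Y$. For $A\ge0$ with $\mathbf{E}A^\kappa=\theta\in(0,1)$, the (normalized) tilted distribution function of $\log A$ is $F_\kappa(x)=\theta^{-1}\mathbf{E}[I(\log A\le x)A^\kappa]$ (the event $A=0$ contributes $0$), where $I$ denotes the indicator. Let $H$ be the distribution function of an arithmetic random variable with span $h$; put $p_k=H(kh)-H(kh-)$ and $p_k^{*2}=(H*H)(kh)-(H*H)(kh-)$, $k\in\mathbb{Z}$. $H$ is called $h$-subexponential, $H\in\mathcal{S}_h$, if $p_{n+1}\sim p_n$ and $p_n^{*2}\sim2p_n$ as $n\to\infty$. For $\kappa,h>0$, $\mathcal{Q}_{\kappa,h}$ denotes the set of functions $q:(0,\infty)\to[0,\infty)$ such that $x^{-\kappa}q(x)$ is nonincreasing and $q(xe^h)=q(x)$ for all $x>0$. $C_q$ denotes the set of continuity points of $q$. *)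

theory Defs
  imports "HOL-Probability.Probability" "HOL-Library.Landau_Symbols"
begin

text \<open>A distribution \<open>N\<close> on the real line is arithmetic if it is carried by a lattice;
  its span is the largest admissible step. The point mass at \<open>0\<close> has no span.\<close>

definition concentrated_on_lattice :: "real measure \<Rightarrow> real \<Rightarrow> bool" where
  "concentrated_on_lattice N h \<longleftrightarrow> h > 0 \<and> (AE y in N. y \<in> range (\<lambda>k::int. of_int k * h))"

definition arithmetic_with_span :: "real measure \<Rightarrow> real \<Rightarrow> bool" where
  "arithmetic_with_span N h \<longleftrightarrow>
     concentrated_on_lattice N h \<and> (\<forall>h'. concentrated_on_lattice N h' \<longrightarrow> h' \<le> h)"

definition jump :: "(real \<Rightarrow> real) \<Rightarrow> real \<Rightarrow> real" where
  "jump H x = H x - Lim (at_left x) H"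

definition lattice_mass :: "real \<Rightarrow> (real \<Rightarrow> real) \<Rightarrow> int \<Rightarrow> real" where
  "lattice_mass h H k = jump H (of_int k * h)"

definition df_convolution :: "(real \<Rightarrow> real) \<Rightarrow> (real \<Rightarrow> real) \<Rightarrow> real \<Rightarrow> real" where
  "df_convolution H K = cdf (interval_measure H \<star> interval_measure K)"

text \<open>The relations \<open>p\<^sub>n\<^sub>+\<^sub>1 \<sim> p\<^sub>n\<close> and \<open>p\<^sub>n\<^sup>*\<^sup>2 \<sim> 2 p\<^sub>n\<close> are stated as limits of quotients, since
  \<^const>\<open>asymp_equiv\<close> also relates two sequences that vanish eventually. As \<open>x / 0 = 0\<close>, a
  limit different from \<open>0\<close> forces \<open>p\<^sub>n \<noteq> 0\<close> for all large \<open>n\<close>.\<close>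

definition lattice_subexponential :: "real \<Rightarrow> (real \<Rightarrow> real) set" where
  "lattice_subexponential h = {H.
     (\<exists>N. real_distribution N \<and> arithmetic_with_span N h \<and> H = cdf N) \<and>
     (\<lambda>n::nat. lattice_mass h H (int n + 1) / lattice_mass h H (int n)) \<longlonglongrightarrow> 1 \<and>
     (\<lambda>n::nat. lattice_mass h (df_convolution H H) (int n) / lattice_mass h H (int n)) \<longlonglongrightarrow> 2}"

text \<open>In the next definition the event \<open>A = 0\<close> contributes nothing: \<open>ln 0 = 0\<close> is a junk value,
  but \<open>0 powr \<kappa> = 0\<close>.\<close>

definition tilted_df :: "'a measure \<Rightarrow> ('a \<Rightarrow> real) \<Rightarrow> real \<Rightarrow> real \<Rightarrow> real" where
  "tilted_df M A \<kappa> x =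
     (LINT \<omega>|M. indicator {\<omega>. ln (A \<omega>) \<le> x} \<omega> * A \<omega> powr \<kappa>) / (LINT \<omega>|M. A \<omega> powr \<kappa>)"

definition log_dist_nonzero :: "'a measure \<Rightarrow> ('a \<Rightarrow> real) \<Rightarrow> real measure" where
  "log_dist_nonzero M A =
     distr (uniform_measure M {\<omega> \<in> space M. A \<omega> \<noteq> 0}) borel (\<lambda>\<omega>. ln (A \<omega>))"

text \<open>Functions on \<open>(0,\<infinity>)\<close> are represented by total functions whose values outside
  \<open>(0,\<infinity>)\<close> are irrelevant.\<close>

definition log_periodic_class :: "real \<Rightarrow> real \<Rightarrow> (real \<Rightarrow> real) set" where
  "log_periodic_class \<kappa> h = {q.
     (\<forall>x>0. 0 \<le> q x) \<and>
     antimono_on {0<..} (\<lambda>x. x powr (-\<kappa>) * q x) \<and>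
     (\<forall>x>0. q (x * exp h) = q x)}"

definition continuity_points :: "(real \<Rightarrow> real) \<Rightarrow> real set" where
  "continuity_points q = {x. x > 0 \<and> isCont q x}"

end

theory Submission imports Defs begin

text \<open>Put \<open>G n = (x e\<^sup>n\<^sup>h)\<^sup>\<kappa> P{X > x e\<^sup>n\<^sup>h}\<close>. Conditioning on \<open>A\<close> turns \<open>P{AX > y}\<close> into a convolution
  with the tilted masses \<open>p\<close>, so \<open>G = g + \<theta> (p * G)\<close> on the integers, where
  \<open>g n = (x e\<^sup>n\<^sup>h)\<^sup>\<kappa> (P{X > x e\<^sup>n\<^sup>h} - P{AX > x e\<^sup>n\<^sup>h})\<close>. By Tonelli, for a dense set of \<open>x\<close> the
  integrability hypothesis makes \<open>g\<close> summable and exponentially small at infinity, hence \<open>o(p)\<close>.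
  Iterating gives \<open>G = \<Sum>\<^sub>m \<theta>\<^sup>m p\<^sup>*\<^sup>m * g\<close>. Subexponentiality yields the limit of each term divided
  by \<open>p n\<close>, and a Kesten-type bound, geometric because \<open>\<theta> < 1\<close>, allows the limits to be summed.
  Thus \<open>G n / p n\<close> converges for a dense set of \<open>x\<close>, and since \<open>P{X > y}\<close> is monotone in \<open>y\<close>, the
  limit extends to all \<open>x\<close>, with convergence wherever the extension is continuous.\<close>

section \<open>Convolution of summable functions on the integers\<close>

text \<open>Two obstacles shape the proof. The convolutions are two-sided: a negative argument
  \<open>k\<close> of one factor moves the other one to \<open>n - k\<close>, arbitrarily far beyond
  \<open>n\<close>. The hypothesis on the supremum bounds \<open>p\<close> there by a multiple of
  \<open>p n\<close>. Moreover, the a priori bound on \<open>G\<close> is only w n = (x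
  e^(nh))^\<kappa>, which grows at infinity, so it is not clear at first that iterating the equation
  loses nothing. Undoing the tilt gives \<theta> (p * w) = P{A \<noteq> 0} w, so w need not shrink
  under iteration. The remainder vanishes because P{X > y} tends to 0, which improves the bound to
  \<epsilon> w plus a constant for every \<epsilon> > 0. The exponent \<delta> is there because p (n
  + 1) / p n -> 1 makes \<open>p\<close> decay more slowly than every exponential: any exponential
  gain in \<open>g\<close> beats it. The integral hypothesis controls almost every scale x, not a
  prescribed one; hence the detour through a dense set.\<close>

definition conv :: "(int \<Rightarrow> real) \<Rightarrow> (int \<Rightarrow> real) \<Rightarrow> int \<Rightarrow> real" where
  "conv a b n = (LINT k|count_space UNIV. a k * b (n - k))"

text \<open>Sums over the integers are integrals over counting measure, so that Tonelli and
  dominated convergence apply. A function that is not absolutely summable gets the value 0; hence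
  the many summability side conditions.\<close>

abbreviation summable_int :: "(int \<Rightarrow> real) \<Rightarrow> bool" where
  "summable_int \<equiv> integrable (count_space UNIV)"

abbreviation sum_int :: "(int \<Rightarrow> real) \<Rightarrow> real" where
  "sum_int \<equiv> integral\<^sup>L (count_space UNIV)"

text \<open>The hypotheses are limits over natural \<open>n\<close>, whereas shifts
  \<open>n - k\<close> and the renewal equation live on the integers.\<close>

lemma tendsto_int_at_top_iff:
  fixes f :: "int \<Rightarrow> 'a::topological_space"
  shows "(f \<longlongrightarrow> l) at_top \<longleftrightarrow> (\<lambda>n. f (int n)) \<longlonglongrightarrow> l"
proof
  assume "(f \<longlongrightarrow> l) at_top"
  then show "(\<lambda>n. f (int n)) \<longlonglongrightarrow> l"
    by (rule filterlim_compose[OF _ filterlim_int_sequentially])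
next
  assume "(\<lambda>n. f (int n)) \<longlonglongrightarrow> l"
  then have "((\<lambda>n. f (int (nat n))) \<longlongrightarrow> l) at_top"
    by (rule filterlim_compose[OF _ filterlim_nat_sequentially])
  moreover have "\<forall>\<^sub>F n in at_top. f (int (nat n)) = f n"
    using eventually_ge_at_top[of 0] by eventually_elim simp
  ultimately show "(f \<longlongrightarrow> l) at_top"
    by (rule Lim_transform_eventually)
qed

lemma eventually_int_at_top_iff:
  "eventually P (at_top :: int filter) \<longleftrightarrow> (\<forall>\<^sub>F n in sequentially. P (int n))"
proof
  assume "eventually P at_top"
  then show "\<forall>\<^sub>F n in sequentially. P (int n)"
    using filterlim_int_sequentially by (rule eventually_compose_filterlim)
next
  assume "\<forall>\<^sub>F n in sequentially. P (int n)"
  then have "\<forall>\<^sub>F n in at_top. P (int (nat n))"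
    using filterlim_nat_sequentially by (rule eventually_compose_filterlim)
  then show "eventually P at_top"
    using eventually_ge_at_top[of 0] by eventually_elim simp
qed

lemma filterlim_minus_const_int: "filterlim (\<lambda>n::int. n - k) at_top at_top"
  unfolding filterlim_at_top
proof
  fix Z show "\<forall>\<^sub>F n in at_top. Z \<le> n - k"
    using eventually_ge_at_top[of "Z + k"] by eventually_elim simp
qed

section \<open>Absolute summability on the integers\<close>

lemma sum_int_reflect:
  "sum_int (\<lambda>k. f (n - k)) = sum_int f" "summable_int (\<lambda>k. f (n - k)) \<longleftrightarrow> summable_int f"
proof -
  have *: "bij_betw (\<lambda>k::int. n - k) UNIV UNIV"
    by (rule bij_betw_byWitness[where f' = "\<lambda>k. n - k"]) auto
  show "sum_int (\<lambda>k. f (n - k)) = sum_int f"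
    by (rule integral_bij_count_space[OF *])
  show "summable_int (\<lambda>k. f (n - k)) \<longleftrightarrow> summable_int f"
    by (rule integrable_bij_count_space[OF *])
qed

lemma summable_int_bounded_mult:
  assumes "summable_int a" "\<And>k. \<bar>f k\<bar> \<le> B"
  shows "summable_int (\<lambda>k. a k * f k)"
proof (rule Bochner_Integration.integrable_bound)
  show "summable_int (\<lambda>k. B * a k)" using assms(1) by simp
  have "\<bar>a k * f k\<bar> \<le> \<bar>B * a k\<bar>" for k
    using mult_mono[OF order_refl[of "\<bar>a k\<bar>"] order_trans[OF assms(2)[of k] abs_ge_self[of B]]]
    by (simp add: abs_mult mult.commute)
  then show "AE k in count_space UNIV. norm (a k * f k) \<le> norm (B * a k)" by simp
qed simp

lemma abs_le_sum_int:
  assumes "summable_int a"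
  shows "\<bar>a k\<bar> \<le> sum_int (\<lambda>j. \<bar>a j\<bar>)"
proof -
  have *: "(\<integral>\<^sup>+j. ennreal \<bar>a j\<bar> \<partial>count_space UNIV) = ennreal (sum_int (\<lambda>j. \<bar>a j\<bar>))"
    using assms by (intro nn_integral_eq_integral) auto
  have "ennreal \<bar>a k\<bar> \<le> ennreal (sum_int (\<lambda>j. \<bar>a j\<bar>))"
    unfolding *[symmetric] by (rule nn_integral_ge_point) simp
  then show ?thesis
    by (subst (asm) ennreal_le_iff) (auto intro: integral_nonneg_AE)
qed

lemma summable_int_conv_integrand:
  assumes "summable_int a" "summable_int b"
  shows "summable_int (\<lambda>k. a k * b (n - k))"
  by (rule summable_int_bounded_mult[OF assms(1)]) (rule abs_le_sum_int[OF assms(2)])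

lemma summable_int_indicator:
  assumes "summable_int f"
  shows "summable_int (\<lambda>k. indicator I k * f k)"
proof -
  have "summable_int (\<lambda>k. f k * indicator I k)"
    by (rule summable_int_bounded_mult[OF assms, of _ 1]) (auto simp: indicator_def)
  then show ?thesis by (simp add: mult.commute)
qed

text \<open>Young's inequality in l^1: after Tonelli the inner sum of
  \<open>\<bar>b (n - k)\<bar>\<close> over \<open>n\<close> does not depend on
  \<open>k\<close>.\<close>

lemma conv_norm:
  assumes "summable_int a" "summable_int b"
  shows "summable_int (conv a b)"
    and "sum_int (\<lambda>n. \<bar>conv a b n\<bar>) \<le> sum_int (\<lambda>n. \<bar>a n\<bar>) * sum_int (\<lambda>n. \<bar>b n\<bar>)"
proof -
  let ?A = "sum_int (\<lambda>n. \<bar>a n\<bar>)" and ?B = "sum_int (\<lambda>n. \<bar>b n\<bar>)"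
  have B0: "?B \<ge> 0" by (rule integral_nonneg_AE) simp
  have nA: "(\<integral>\<^sup>+k. ennreal \<bar>a k\<bar> \<partial>count_space UNIV) = ennreal ?A"
    using assms by (intro nn_integral_eq_integral) auto
  have nB: "(\<integral>\<^sup>+k. ennreal \<bar>b k\<bar> \<partial>count_space UNIV) = ennreal ?B"
    using assms by (intro nn_integral_eq_integral) auto
  have nBs: "(\<integral>\<^sup>+n. ennreal \<bar>b (n - k)\<bar> \<partial>count_space UNIV) = ennreal ?B" for k
  proof -
    have *: "bij_betw (\<lambda>n::int. n - k) UNIV UNIV"
      by (rule bij_betw_byWitness[where f' = "\<lambda>n. n + k"]) auto
    show ?thesis
      using nn_integral_bij_count_space[OF *, of "\<lambda>n. ennreal \<bar>b n\<bar>"] nB by simp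
  qed
  have le: "ennreal \<bar>conv a b n\<bar> \<le> (\<integral>\<^sup>+k. ennreal (\<bar>a k\<bar> * \<bar>b (n - k)\<bar>) \<partial>count_space UNIV)" for n
    using integral_norm_bound_ennreal[OF summable_int_conv_integrand[OF assms, of n]]
    by (simp add: conv_def abs_mult)
  have "(\<integral>\<^sup>+n. ennreal \<bar>conv a b n\<bar> \<partial>count_space UNIV)
      \<le> (\<integral>\<^sup>+n. \<integral>\<^sup>+k. ennreal (\<bar>a k\<bar> * \<bar>b (n - k)\<bar>) \<partial>count_space UNIV \<partial>count_space UNIV)"
    by (intro nn_integral_mono le)
  also have "\<dots> = (\<integral>\<^sup>+k. \<integral>\<^sup>+n. ennreal (\<bar>a k\<bar> * \<bar>b (n - k)\<bar>) \<partial>count_space UNIV \<partial>count_space UNIV)"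
    by (rule nn_integral_count_space_nn_integral) auto
  also have "\<dots> = (\<integral>\<^sup>+k. ennreal \<bar>a k\<bar> * ennreal ?B \<partial>count_space UNIV)"
    by (simp add: ennreal_mult nn_integral_cmult nBs)
  also have "\<dots> = ennreal (?A * ?B)"
    by (simp add: nn_integral_multc nA ennreal_mult B0)
  finally have fin: "(\<integral>\<^sup>+n. ennreal \<bar>conv a b n\<bar> \<partial>count_space UNIV) \<le> ennreal (?A * ?B)" .
  show 1: "summable_int (conv a b)"
    by (rule integrableI_bounded) (simp_all add: order.strict_trans1[OF fin])
  have "ennreal (sum_int (\<lambda>n. \<bar>conv a b n\<bar>)) \<le> ennreal (?A * ?B)"
    using fin nn_integral_eq_integral[of "count_space UNIV" "\<lambda>n. \<bar>conv a b n\<bar>"] 1 by simp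
  then show "sum_int (\<lambda>n. \<bar>conv a b n\<bar>) \<le> ?A * ?B"
    using B0 by (subst (asm) ennreal_le_iff) auto
qed

lemma tendsto_sum_int_atMost:
  assumes "summable_int f"
  shows "((\<lambda>K. sum_int (\<lambda>k. indicator {..K} k * f k)) \<longlongrightarrow> sum_int f) at_top"
  unfolding tendsto_int_at_top_iff
proof (rule integral_dominated_convergence)
  show "summable_int (\<lambda>k. \<bar>f k\<bar>)" using assms by simp
  have "(\<lambda>i. indicator {..int i} k * f k) \<longlonglongrightarrow> f k" for k
  proof (rule tendsto_eventually)
    show "\<forall>\<^sub>F i in sequentially. indicator {..int i} k * f k = f k"
      using eventually_ge_at_top[of "nat k"] by eventually_elim auto
  qed
  then show "AE k in count_space UNIV. (\<lambda>i. indicator {..int i} k * f k) \<longlonglongrightarrow> f k" by simp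
qed (auto simp: indicator_def)

text \<open>The cut-off \<open>K\<close> separates small indices, where only summability is
  available, from large ones, where a factor can be compared with \<open>p\<close>: in
  \<open>mid\<close> both \<open>k\<close> and \<open>n - k\<close> exceed \<open>K\<close>. The two
  end ranges are \<open>low\<close> with the factors swapped.\<close>

definition mid :: "int \<Rightarrow> (int \<Rightarrow> real) \<Rightarrow> (int \<Rightarrow> real) \<Rightarrow> int \<Rightarrow> real" where
  "mid K a b n = sum_int (\<lambda>k. indicator {K<..<n-K} k * (a k * b (n - k)))"

definition low :: "int \<Rightarrow> (int \<Rightarrow> real) \<Rightarrow> (int \<Rightarrow> real) \<Rightarrow> int \<Rightarrow> real" where
  "low K a b n = sum_int (\<lambda>k. indicator {..K} k * (a k * b (n - k)))"

text \<open>The reflection of \<open>k\<close> to \<open>n - k\<close> carries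
  \<open>low K b a\<close> to the range k \<ge> n - K, which is disjoint from k \<le> K because n >
  2K.\<close>

lemma conv_split:
  assumes "summable_int a" "summable_int b" "n > 2 * K"
  shows "conv a b n = low K a b n + low K b a n + mid K a b n"
proof -
  let ?f = "\<lambda>k. a k * b (n - k)"
  have s: "summable_int (\<lambda>k. indicator I k * ?f k)" for I
    by (intro summable_int_indicator summable_int_conv_integrand assms)
  have "low K b a n = sum_int (\<lambda>k. indicator {n-K..} k * ?f k)"
    unfolding low_def
    by (subst sum_int_reflect(1)[symmetric, of _ n])
       (auto intro!: Bochner_Integration.integral_cong simp: indicator_def)
  then have "low K a b n + low K b a n + mid K a b n =
     sum_int (\<lambda>k. indicator {..K} k * ?f k + indicator {n-K..} k * ?f k + indicator {K<..<n-K} k * ?f k)"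
    by (simp add: low_def mid_def s)
  also have "\<dots> = conv a b n"
    unfolding conv_def
    by (intro Bochner_Integration.integral_cong) (use assms(3) in \<open>auto simp: indicator_def\<close>)
  finally show ?thesis ..
qed

lemma summable_int_halves:
  assumes "summable (\<lambda>n. \<bar>f (int n)\<bar>)" "summable (\<lambda>n. \<bar>f (- int n)\<bar>)"
  shows "summable_int f"
proof -
  have "bij_betw int UNIV {0..}"
    by (rule bij_betw_byWitness[where f' = nat]) auto
  from integrable_bij_count_space[OF this, of f] have 1: "integrable (count_space {0..}) f"
    using assms(1) by (simp add: integrable_count_space_nat_iff)
  have "bij_betw (\<lambda>n. - int n) UNIV {..0}"
    by (rule bij_betw_byWitness[where f' = "\<lambda>k. nat (- k)"]) auto
  from integrable_bij_count_space[OF this, of f] have 2: "integrable (count_space {..0}) f"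
    using assms(2) by (simp add: integrable_count_space_nat_iff)
  have "{0..} \<union> {..0} = (UNIV :: int set)" by auto
  with Infinite_Set_Sum.abs_summable_on_union[unfolded Infinite_Set_Sum.abs_summable_on_def, OF 1 2]
  show ?thesis by simp
qed

section \<open>Locally subexponential masses and the defective renewal equation\<close>

text \<open>\<open>p_tail\<close> is the hypothesis on the supremum with the supremum unfolded; it
  is what makes negative arguments in a convolution harmless.\<close>

locale local_subexponential =
  fixes p :: "int \<Rightarrow> real"
  assumes p_nonneg: "\<And>k. 0 \<le> p k"
    and p_summable: "summable_int p"
    and p_sum: "sum_int p = 1"
    and p_ratio: "((\<lambda>n. p (n + 1) / p n) \<longlongrightarrow> 1) at_top"
    and p_conv: "((\<lambda>n. conv p p n / p n) \<longlongrightarrow> 2) at_top"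
    and p_tail: "\<exists>C. \<forall>\<^sub>F n in at_top. \<forall>k\<ge>n. p k \<le> C * p n"
begin

text \<open>Division by 0 yields 0, so a ratio above 1/2 excludes a vanishing \<open>p n\<close>.
  This justifies the later cancellations.\<close>

lemma p_pos: "\<forall>\<^sub>F n in at_top. p n > 0"
proof -
  have "\<forall>\<^sub>F n in at_top. p (n + 1) / p n > 1 / 2"
    by (rule order_tendstoD(1)[OF p_ratio]) simp
  then show ?thesis
  proof eventually_elim
    case (elim n)
    then have "p n \<noteq> 0" by auto
    then show ?case using p_nonneg[of n] by simp
  qed
qed

lemma p_ratio_shift: "((\<lambda>n. p (n - k) / p n) \<longlongrightarrow> 1) at_top"
proof (induction k rule: int_induct[where k = 0])
  case base
  have "\<forall>\<^sub>F n in at_top. 1 = p (n - 0) / p n"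
    using p_pos by eventually_elim simp
  then show ?case by (rule Lim_transform_eventually[OF tendsto_const])
next
  case (step1 i)
  have "((\<lambda>n. p (n - (i+1) + 1) / p (n - (i+1))) \<longlongrightarrow> 1) at_top"
    by (rule filterlim_compose[OF p_ratio filterlim_minus_const_int])
  from tendsto_divide[OF step1(2) this]
  have *: "((\<lambda>n. (p (n - i) / p n) / (p (n - i) / p (n - (i + 1)))) \<longlongrightarrow> 1) at_top"
    by (simp add: algebra_simps)
  have "\<forall>\<^sub>F n in at_top. p (n - i) > 0"
    using p_pos filterlim_minus_const_int by (rule eventually_compose_filterlim)
  then have "\<forall>\<^sub>F n in at_top. (p (n - i) / p n) / (p (n - i) / p (n - (i + 1))) = p (n - (i + 1)) / p n"
    by eventually_elim (simp add: field_simps)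
  then show ?case by (rule Lim_transform_eventually[OF *])
next
  case (step2 i)
  have "((\<lambda>n. p (n - i + 1) / p (n - i)) \<longlongrightarrow> 1) at_top"
    by (rule filterlim_compose[OF p_ratio filterlim_minus_const_int])
  from tendsto_mult[OF this step2(2)]
  have *: "((\<lambda>n. (p (n - i + 1) / p (n - i)) * (p (n - i) / p n)) \<longlongrightarrow> 1) at_top"
    by simp
  have "\<forall>\<^sub>F n in at_top. p (n - i) > 0"
    using p_pos filterlim_minus_const_int by (rule eventually_compose_filterlim)
  then have "\<forall>\<^sub>F n in at_top. (p (n - i + 1) / p (n - i)) * (p (n - i) / p n) = p (n - (i - 1)) / p n"
    by eventually_elim (simp add: field_simps)
  then show ?case by (rule Lim_transform_eventually[OF *])
qed

text \<open>Since p (n - K) / p n -> 1, moving the starting point back by \<open>K\<close> costs at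
  most a factor 2. One constant serves all \<open>K\<close>; only the threshold in \<open>n\<close>
  depends on it.\<close>

lemma p_tail_shift:
  obtains C where "C \<ge> 0" "\<And>K. \<forall>\<^sub>F n in at_top. \<forall>j\<ge>n-K. p j \<le> C * p n"
proof -
  obtain C0 where C0: "\<forall>\<^sub>F n in at_top. \<forall>k\<ge>n. p k \<le> C0 * p n"
    using p_tail by blast
  define C where "C = \<bar>C0\<bar>"
  have "\<forall>\<^sub>F n in at_top. \<forall>j\<ge>n-K. p j \<le> 2 * C * p n" for K
  proof -
    have 1: "\<forall>\<^sub>F n in at_top. \<forall>k\<ge>n-K. p k \<le> C0 * p (n - K)"
      using C0 filterlim_minus_const_int by (rule eventually_compose_filterlim)
    have 2: "\<forall>\<^sub>F n in at_top. p (n - K) / p n < 2"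
      by (rule order_tendstoD(2)[OF p_ratio_shift]) simp
    show ?thesis using 1 2 p_pos
    proof eventually_elim
      case (elim n)
      show ?case
      proof safe
        fix j assume "j \<ge> n - K"
        then have "p j \<le> C0 * p (n - K)" using elim by blast
        also have "\<dots> \<le> C * p (n - K)"
          unfolding C_def by (intro mult_right_mono p_nonneg) simp
        also have "\<dots> \<le> C * (2 * p n)"
          using elim by (intro mult_left_mono) (auto simp: C_def field_simps)
        finally show "p j \<le> 2 * C * p n" by simp
      qed
    qed
  qed
  moreover have "2 * C \<ge> 0" by (simp add: C_def)
  ultimately show ?thesis using that by blast
qed

lemma tendsto_ratio_bounded:
  assumes "((\<lambda>n. b n / p n) \<longlongrightarrow> \<beta>) at_top"
  obtains B where "B > 0" "\<forall>\<^sub>F n in at_top. \<bar>b n\<bar> \<le> B * p n"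
proof -
  have "((\<lambda>n. \<bar>b n / p n\<bar>) \<longlongrightarrow> \<bar>\<beta>\<bar>) at_top" by (intro tendsto_rabs assms)
  \<comment> \<open>The added 1 keeps the constant positive even for \<beta> = 0, so that later
    tolerances can be divided by it.\<close>
  then have "\<forall>\<^sub>F n in at_top. \<bar>b n / p n\<bar> < \<bar>\<beta>\<bar> + 1"
    by (rule order_tendstoD) simp
  with p_pos have "\<forall>\<^sub>F n in at_top. \<bar>b n\<bar> \<le> (\<bar>\<beta>\<bar> + 1) * p n"
    by eventually_elim (simp add: abs_divide field_simps)
  then show ?thesis by (intro that[of "\<bar>\<beta>\<bar> + 1"]) auto
qed

text \<open>Dominated convergence: b (n - k) / p n tends to \<beta> for each fixed \<open>k\<close>,
  and for all k \<le> K, however negative, b (n - k) is bounded by B p (n - k) and thus by B C p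
  n.\<close>

lemma low_limit:
  assumes a: "summable_int a" and b: "((\<lambda>n. b n / p n) \<longlongrightarrow> \<beta>) at_top"
  shows "((\<lambda>n. low K a b n / p n) \<longlongrightarrow> \<beta> * sum_int (\<lambda>k. indicator {..K} k * a k)) at_top"
proof -
  obtain B where B: "B > 0" "\<forall>\<^sub>F n in at_top. \<bar>b n\<bar> \<le> B * p n"
    using tendsto_ratio_bounded[OF b] by blast
  obtain C where C: "C \<ge> 0" "\<And>K. \<forall>\<^sub>F n in at_top. \<forall>j\<ge>n-K. p j \<le> C * p n"
    using p_tail_shift by blast
  obtain N where N: "\<And>n. n \<ge> N \<Longrightarrow> \<bar>b n\<bar> \<le> B * p n"
    using B(2) unfolding eventually_at_top_linorder by blast
  have bnd: "\<forall>\<^sub>F n in at_top. \<forall>k\<le>K. \<bar>b (n - k)\<bar> / p n \<le> B * C"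
    using C(2)[of K] p_pos eventually_ge_at_top[of "N + K"]
  proof eventually_elim
    case (elim n)
    show ?case
    proof safe
      fix k assume "k \<le> K"
      then have "\<bar>b (n - k)\<bar> \<le> B * p (n - k)" using N elim by simp
      also have "\<dots> \<le> B * (C * p n)" using elim B \<open>k \<le> K\<close> by (intro mult_left_mono) auto
      finally show "\<bar>b (n - k)\<bar> / p n \<le> B * C" using elim by (simp add: field_simps)
    qed
  qed
  then obtain m where m: "\<And>n k. n \<ge> m \<Longrightarrow> k \<le> K \<Longrightarrow> \<bar>b (int n - k)\<bar> / p (int n) \<le> B * C"
    unfolding eventually_int_at_top_iff eventually_sequentially by blast
  have b_shift: "((\<lambda>n. b (n - k) / p n) \<longlongrightarrow> \<beta>) at_top" for k
  proof -
    have "((\<lambda>n. b (n - k) / p (n - k)) \<longlongrightarrow> \<beta>) at_top"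
      by (rule filterlim_compose[OF b filterlim_minus_const_int])
    from tendsto_mult[OF this p_ratio_shift[of k]]
    have *: "((\<lambda>n. (b (n - k) / p (n - k)) * (p (n - k) / p n)) \<longlongrightarrow> \<beta>) at_top" by simp
    have "\<forall>\<^sub>F n in at_top. p (n - k) > 0"
      using p_pos filterlim_minus_const_int by (rule eventually_compose_filterlim)
    then have "\<forall>\<^sub>F n in at_top. (b (n - k) / p (n - k)) * (p (n - k) / p n) = b (n - k) / p n"
      by eventually_elim simp
    then show ?thesis by (rule Lim_transform_eventually[OF *])
  qed
  \<comment> \<open>The domination holds from \<open>m\<close> on, but the convergence theorem wants
    it for every term; the shift by \<open>m\<close> is undone by
    \<open>LIMSEQ_offset\<close>.\<close>
  have "(\<lambda>n. sum_int (\<lambda>k. indicator {..K} k * (a k * b (int (n + m) - k)) / p (int (n + m))))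
     \<longlonglongrightarrow> sum_int (\<lambda>k. \<beta> * (indicator {..K} k * a k))"
  proof (rule integral_dominated_convergence)
    show "summable_int (\<lambda>k. B * C * \<bar>a k\<bar>)" using a by simp
    have "(\<lambda>n. indicator {..K} k * (a k * b (int (n + m) - k)) / p (int (n + m)))
      \<longlonglongrightarrow> \<beta> * (indicator {..K} k * a k)" for k
    proof -
      have "(\<lambda>n. b (int n - k) / p (int n)) \<longlonglongrightarrow> \<beta>"
        using b_shift[of k] unfolding tendsto_int_at_top_iff .
      from LIMSEQ_ignore_initial_segment[OF this, of m]
      have "(\<lambda>n. b (int (n + m) - k) / p (int (n + m))) \<longlonglongrightarrow> \<beta>" .
      from tendsto_mult[OF tendsto_const this, of "indicator {..K} k * a k"]
      show ?thesis by (simp add: mult_ac)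
    qed
    then show "AE k in count_space UNIV.
      (\<lambda>n. indicator {..K} k * (a k * b (int (n + m) - k)) / p (int (n + m)))
      \<longlonglongrightarrow> \<beta> * (indicator {..K} k * a k)" by simp
    have "\<bar>indicator {..K} k * (a k * b (int (n + m) - k)) / p (int (n + m))\<bar> \<le> B * C * \<bar>a k\<bar>" for n k
    proof (cases "k \<le> K")
      case True
      have "\<bar>a k\<bar> * (\<bar>b (int (n + m) - k)\<bar> / p (int (n + m))) \<le> \<bar>a k\<bar> * (B * C)"
        by (intro mult_left_mono m True) auto
      then show ?thesis
        using True p_nonneg[of "int (n + m)"] by (simp add: abs_mult abs_divide mult_ac)
    qed (use B C in simp)
    then show "\<And>n. AE k in count_space UNIV.
      norm (indicator {..K} k * (a k * b (int (n + m) - k)) / p (int (n + m))) \<le> B * C * \<bar>a k\<bar>" by simp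
  qed auto
  then have "(\<lambda>n. low K a b (int (n + m)) / p (int (n + m)))
     \<longlonglongrightarrow> \<beta> * sum_int (\<lambda>k. indicator {..K} k * a k)"
    by (simp add: low_def)
  then have "(\<lambda>n. low K a b (int n) / p (int n)) \<longlonglongrightarrow> \<beta> * sum_int (\<lambda>k. indicator {..K} k * a k)"
    by (rule LIMSEQ_offset)
  then show ?thesis unfolding tendsto_int_at_top_iff .
qed

lemma p_self_ratio: "((\<lambda>n. p n / p n) \<longlongrightarrow> 1) at_top"
  using p_ratio_shift[of 0] by simp

text \<open>In a convolution of \<open>p\<close> with itself the two ranges \<open>k \<le> K\<close> and \<open>n - k \<le> K\<close> already
  account for almost all of the limit \<open>2\<close>.\<close>

lemma mid_negligible:
  assumes "\<epsilon> > 0"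
  shows "\<forall>\<^sub>F K in at_top. \<forall>\<^sub>F n in at_top. mid K p p n \<le> \<epsilon> * p n"
proof -
  let ?P = "\<lambda>K. sum_int (\<lambda>k. indicator {..K} k * p k)"
  \<comment> \<open>Both end ranges have the limit \<open>?P K\<close>, so the middle keeps 2 - 2
    \<open>?P K\<close>, which is then below \<epsilon>.\<close>
  have "\<forall>\<^sub>F K in at_top. ?P K > 1 - \<epsilon> / 2"
    by (rule order_tendstoD(1)[OF tendsto_sum_int_atMost[OF p_summable]])
       (use assms in \<open>simp add: p_sum\<close>)
  then show ?thesis
  proof eventually_elim
    case (elim K)
    have "((\<lambda>n. conv p p n / p n - 2 * (low K p p n / p n)) \<longlongrightarrow> 2 - 2 * (1 * ?P K)) at_top"
      by (intro tendsto_diff p_conv tendsto_mult tendsto_const low_limit p_summable p_self_ratio)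
    then have "\<forall>\<^sub>F n in at_top. conv p p n / p n - 2 * (low K p p n / p n) < \<epsilon>"
      by (rule order_tendstoD) (use elim in simp)
    with p_pos eventually_gt_at_top[of "2 * K"] show ?case
    proof eventually_elim
      case (elim n)
      have "mid K p p n = p n * (conv p p n / p n - 2 * (low K p p n / p n))"
        using conv_split[OF p_summable p_summable, of K n] elim by (simp add: field_simps)
      also have "\<dots> \<le> p n * \<epsilon>" using elim by (intro mult_left_mono) auto
      finally show ?case by (simp add: mult.commute)
    qed
  qed
qed

text \<open>On the middle range n - k > K, so a bound on \<open>b\<close> beyond \<open>K\<close>
  suffices, whatever \<open>b\<close> does elsewhere.\<close>

lemma mid_bound:
  assumes b: "summable_int b" and B: "\<And>m. m > K \<Longrightarrow> \<bar>b m\<bar> \<le> B * p m"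
  shows "\<bar>mid K p b n\<bar> \<le> B * mid K p p n"
proof -
  have "\<bar>mid K p b n\<bar> \<le> sum_int (\<lambda>k. \<bar>indicator {K<..<n-K} k * (p k * b (n - k))\<bar>)"
    unfolding mid_def by (rule integral_abs_bound)
  also have "\<dots> \<le> sum_int (\<lambda>k. B * (indicator {K<..<n-K} k * (p k * p (n - k))))"
  proof (rule integral_mono)
    show "summable_int (\<lambda>k. \<bar>indicator {K<..<n-K} k * (p k * b (n - k))\<bar>)"
      by (intro integrable_abs summable_int_indicator summable_int_conv_integrand p_summable b)
    show "summable_int (\<lambda>k. B * (indicator {K<..<n-K} k * (p k * p (n - k))))"
      by (intro integrable_mult_right summable_int_indicator summable_int_conv_integrand p_summable)
    show "\<bar>indicator {K<..<n-K} k * (p k * b (n - k))\<bar>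
        \<le> B * (indicator {K<..<n-K} k * (p k * p (n - k)))" for k
      using mult_left_mono[OF B[of "n - k"] p_nonneg[of k]] p_nonneg[of k]
      by (auto simp: indicator_def abs_mult mult_ac)
  qed
  finally show ?thesis by (simp add: mid_def)
qed

text \<open>The principle of a single large jump: either \<open>b\<close> stays at a bounded
  argument and \<open>p\<close> makes the jump, giving \<open>sum_int b\<close>, or \<open>p\<close>
  stays bounded and \<open>b\<close> makes it, giving \<beta> times the mass 1 of \<open>p\<close>.
  Both jumping at once is the middle range.\<close>

lemma conv_limit:
  assumes b: "summable_int b" and lim: "((\<lambda>n. b n / p n) \<longlongrightarrow> \<beta>) at_top"
  shows "((\<lambda>n. conv p b n / p n) \<longlongrightarrow> \<beta> + sum_int b) at_top"
proof (rule tendstoI)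
  fix e :: real assume e: "e > 0"
  let ?P = "\<lambda>K. sum_int (\<lambda>k. indicator {..K} k * p k)"
  let ?b = "\<lambda>K. sum_int (\<lambda>k. indicator {..K} k * b k)"
  obtain B where B: "B > 0" "\<forall>\<^sub>F n in at_top. \<bar>b n\<bar> \<le> B * p n"
    using tendsto_ratio_bounded[OF lim] by blast
  have 1: "((\<lambda>K. \<beta> * ?P K + 1 * ?b K) \<longlongrightarrow> \<beta> * 1 + 1 * sum_int b) at_top"
    unfolding p_sum[symmetric]
    by (intro tendsto_intros tendsto_sum_int_atMost p_summable b)
  \<comment> \<open>The error e is shared by the truncation of the two sums at \<open>K\<close>, the
    convergence of the end ranges, and the middle range, whose tolerance anticipates the factor
    \<open>B\<close> of \<open>mid_bound\<close>.\<close>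
  have "\<forall>\<^sub>F K in at_top. dist (\<beta> * ?P K + 1 * ?b K) (\<beta> * 1 + 1 * sum_int b) < e / 3
      \<and> (\<forall>\<^sub>F n in at_top. mid K p p n \<le> e / (3 * B) * p n) \<and> (\<forall>m\<ge>K. \<bar>b m\<bar> \<le> B * p m)"
    using B e
    by (intro eventually_conj tendstoD[OF 1] mid_negligible eventually_all_ge_at_top) auto
  then obtain K where K: "dist (\<beta> * ?P K + 1 * ?b K) (\<beta> * 1 + 1 * sum_int b) < e / 3"
      "\<forall>\<^sub>F n in at_top. mid K p p n \<le> e / (3 * B) * p n" "\<forall>m\<ge>K. \<bar>b m\<bar> \<le> B * p m"
    using eventually_happens'[OF trivial_limit_at_top_linorder] by blast
  have "((\<lambda>n. low K p b n / p n + low K b p n / p n) \<longlongrightarrow> \<beta> * ?P K + 1 * ?b K) at_top"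
    by (intro tendsto_add low_limit p_summable lim b p_self_ratio)
  then have "\<forall>\<^sub>F n in at_top. dist (low K p b n / p n + low K b p n / p n) (\<beta> * ?P K + 1 * ?b K) < e / 3"
    by (rule tendstoD) (use e in simp)
  with K(2) p_pos eventually_gt_at_top[of "2 * K"]
  show "\<forall>\<^sub>F n in at_top. dist (conv p b n / p n) (\<beta> + sum_int b) < e"
  proof eventually_elim
    case (elim n)
    have "\<bar>mid K p b n\<bar> \<le> B * mid K p p n"
      by (rule mid_bound[OF b]) (use K(3) in auto)
    also have "\<dots> \<le> B * (e / (3 * B) * p n)" using elim B by (intro mult_left_mono) auto
    finally have "\<bar>mid K p b n / p n\<bar> \<le> e / 3" using elim B by (simp add: field_simps)
    moreover have "conv p b n / p n = low K p b n / p n + low K b p n / p n + mid K p b n / p n"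
      using conv_split[OF p_summable b, of K n] elim by (simp add: add_divide_distrib)
    ultimately show ?case using elim(4) K(1) unfolding dist_real_def by linarith
  qed
qed

text \<open>Once every ratio exceeds exp (-c), the product p n exp (c n) is nondecreasing, so it
  stays above its first value.\<close>

lemma exp_lower_bound:
  assumes "0 < c"
  obtains b where "b > 0" "\<forall>\<^sub>F n in sequentially. b \<le> p (int n) * exp (c * real n)"
proof -
  have "\<forall>\<^sub>F n in at_top. p (n + 1) / p n > exp (- c)"
    by (rule order_tendstoD(1)[OF p_ratio]) (use assms in simp)
  with p_pos have "\<forall>\<^sub>F n in at_top. p (n + 1) / p n > exp (- c) \<and> p n > 0"
    by eventually_elim simp
  then obtain m where m: "\<And>n. n \<ge> m \<Longrightarrow> p (int n + 1) / p (int n) > exp (- c) \<and> p (int n) > 0"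
    unfolding eventually_int_at_top_iff eventually_sequentially by blast
  define b where "b = p (int m) * exp (c * real m)"
  have "b \<le> p (int n) * exp (c * real n)" if "n \<ge> m" for n
    using that
  proof (induction n rule: dec_induct)
    case (step n)
    have "p (int n) \<le> p (int n + 1) * exp c"
    proof -
      have "p (int n + 1) / p (int n) > exp (- c)" "p (int n) > 0" using m[of n] step by auto
      then show ?thesis by (simp add: exp_minus field_simps)
    qed
    then have "p (int n) * exp (c * real n) \<le> p (int n + 1) * exp c * exp (c * real n)"
      by (intro mult_right_mono) auto
    also have "\<dots> = p (int (Suc n)) * exp (c * real (Suc n))"
      by (simp add: algebra_simps exp_add[symmetric])
    finally show ?case using step by linarith
  qed (simp add: b_def)
  then show ?thesis using m[of m] by (intro that[of b]) (auto simp: b_def eventually_sequentially)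
qed

section \<open>Iteration of the renewal operator\<close>

definition renewal_step :: "real \<Rightarrow> (int \<Rightarrow> real) \<Rightarrow> int \<Rightarrow> real" where
  "renewal_step \<theta> b n = \<theta> * conv p b n"

lemma renewal_step_summable:
  assumes "summable_int b" "0 \<le> \<theta>"
  shows "summable_int (renewal_step \<theta> b)"
    and "sum_int (\<lambda>n. \<bar>renewal_step \<theta> b n\<bar>) \<le> \<theta> * sum_int (\<lambda>n. \<bar>b n\<bar>)"
proof -
  have eq: "renewal_step \<theta> b = (\<lambda>n. \<theta> * conv p b n)"
    by (rule ext) (simp add: renewal_step_def)
  show "summable_int (renewal_step \<theta> b)"
    unfolding eq by (intro integrable_mult_right conv_norm(1)[OF p_summable assms(1)])
  have "sum_int (\<lambda>n. \<bar>renewal_step \<theta> b n\<bar>) = \<theta> * sum_int (\<lambda>n. \<bar>conv p b n\<bar>)"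
    using assms by (simp add: eq abs_mult)
  also have "\<dots> \<le> \<theta> * (sum_int (\<lambda>n. \<bar>p n\<bar>) * sum_int (\<lambda>n. \<bar>b n\<bar>))"
    by (intro mult_left_mono conv_norm(2) p_summable assms)
  finally show "sum_int (\<lambda>n. \<bar>renewal_step \<theta> b n\<bar>) \<le> \<theta> * sum_int (\<lambda>n. \<bar>b n\<bar>)"
    using p_sum p_nonneg by simp
qed

text \<open>Iterating the operator instead of forming convolution powers of \<open>p\<close> avoids
  associativity of \<open>conv\<close>. Each step contracts the l^1 norm by \<theta>, as
  \<open>p\<close> has mass 1.\<close>

lemma renewal_iterate_summable:
  assumes "summable_int g" "0 \<le> \<theta>"
  shows "summable_int ((renewal_step \<theta> ^^ m) g)"
    and "sum_int (\<lambda>n. \<bar>(renewal_step \<theta> ^^ m) g n\<bar>) \<le> \<theta> ^ m * sum_int (\<lambda>n. \<bar>g n\<bar>)"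
proof (induction m)
  case (Suc m)
  case 1 show ?case using renewal_step_summable(1)[OF Suc(1) assms(2)] by simp
  case 2
  have "\<theta> * sum_int (\<lambda>n. \<bar>(renewal_step \<theta> ^^ m) g n\<bar>) \<le> \<theta> * (\<theta> ^ m * sum_int (\<lambda>n. \<bar>g n\<bar>))"
    using Suc(2) assms(2) by (rule mult_left_mono)
  with renewal_step_summable(2)[OF Suc(1) assms(2)] show ?case by (simp add: mult_ac)
qed (use assms in auto)

text \<open>By \<open>conv_limit\<close> the next limit is \<theta> times the sum of the current
  limit and the total of the current iterate. Only existence is recorded, since the theorem does not
  identify q.\<close>

lemma renewal_iterate_limit:
  assumes "summable_int g" "0 \<le> \<theta>" "((\<lambda>n. g n / p n) \<longlongrightarrow> 0) at_top"
  shows "\<exists>d. ((\<lambda>n. (renewal_step \<theta> ^^ m) g n / p n) \<longlongrightarrow> d) at_top"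
proof (induction m)
  case (Suc m)
  then obtain d where "((\<lambda>n. (renewal_step \<theta> ^^ m) g n / p n) \<longlongrightarrow> d) at_top" by blast
  from tendsto_mult[OF tendsto_const[of \<theta>]
      conv_limit[OF renewal_iterate_summable(1)[OF assms(1,2)] this]]
  show ?case by (auto simp: renewal_step_def[of \<theta> "(renewal_step \<theta> ^^ m) g"])
qed (use assms in auto)

text \<open>Kesten's bound: the cut-off \<open>K\<close> and the threshold are chosen before the iteration starts,
  so that the middle range costs the same factor at every step.\<close>

lemma renewal_iterate_bound:
  assumes g: "summable_int g" and \<theta>: "0 < \<theta>" "\<theta> < 1"
    and lim: "((\<lambda>n. g n / p n) \<longlongrightarrow> 0) at_top"
  shows "\<exists>B \<rho> K. 0 < \<rho> \<and> \<rho> < 1 \<and>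
    (\<forall>m. \<forall>n>K. \<bar>(renewal_step \<theta> ^^ m) g n\<bar> \<le> B * (real m + 1) * \<rho> ^ m * p n)"
proof -
  \<comment> \<open>Chosen so that \<theta> (1 + 2 \<epsilon>) is the midpoint \<rho> of \<theta>
    and 1: the end range with \<open>p\<close> at small arguments costs 1 + \<epsilon>, the middle
    range \<epsilon>.\<close>
  define \<epsilon> where "\<epsilon> = (1 - \<theta>) / (4 * \<theta>)"
  have \<epsilon>: "\<epsilon> > 0" using \<theta> by (simp add: \<epsilon>_def)
  define \<rho> where "\<rho> = (1 + \<theta>) / 2"
  have \<rho>: "0 < \<rho>" "\<rho> < 1" "\<theta> \<le> \<rho>" using \<theta> by (auto simp: \<rho>_def)
  have \<rho>_eq: "\<rho> = \<theta> * (1 + 2 * \<epsilon>)" using \<theta> by (simp add: \<rho>_def \<epsilon>_def field_simps)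
  let ?P = "\<lambda>K. sum_int (\<lambda>k. indicator {..K} k * p k)"
  let ?g = "sum_int (\<lambda>n. \<bar>g n\<bar>)"
  let ?D = "\<lambda>m. (renewal_step \<theta> ^^ m) g"
  have g0: "?g \<ge> 0" by (rule integral_nonneg_AE) simp
  obtain B0 where B0: "B0 > 0" "\<forall>\<^sub>F n in at_top. \<bar>g n\<bar> \<le> B0 * p n"
    using tendsto_ratio_bounded[OF lim] by blast
  obtain C where C: "C \<ge> 0" "\<And>K. \<forall>\<^sub>F n in at_top. \<forall>j\<ge>n-K. p j \<le> C * p n"
    using p_tail_shift by blast
  have "\<forall>\<^sub>F K in at_top. (\<forall>\<^sub>F n in at_top. mid K p p n \<le> \<epsilon> * p n)
      \<and> (\<forall>n\<ge>K. \<bar>g n\<bar> \<le> B0 * p n) \<and> (\<forall>n\<ge>K. p n > 0)"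
    by (intro eventually_conj mid_negligible eventually_all_ge_at_top B0(2) p_pos \<epsilon>)
  then obtain K where K: "\<forall>\<^sub>F n in at_top. mid K p p n \<le> \<epsilon> * p n"
      "\<And>n. n \<ge> K \<Longrightarrow> \<bar>g n\<bar> \<le> B0 * p n" "\<And>n. n \<ge> K \<Longrightarrow> p n > 0"
    using eventually_happens'[OF trivial_limit_at_top_linorder] by blast
  have "?P K \<le> sum_int p"
    by (intro integral_mono summable_int_indicator p_summable) (auto simp: indicator_def p_nonneg)
  then have "\<forall>\<^sub>F n in at_top. low K p p n / p n < 1 + \<epsilon>"
    using \<epsilon> p_sum by (intro order_tendstoD(2)[OF low_limit[OF p_summable p_self_ratio]]) simp
  with K(1) C(2)[of K] have "\<forall>\<^sub>F n in at_top. mid K p p n \<le> \<epsilon> * p n \<and>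
      (\<forall>j\<ge>n-K. p j \<le> C * p n) \<and> low K p p n / p n < 1 + \<epsilon>"
    by eventually_elim simp
  then obtain N0 where N0: "\<And>n. n \<ge> N0 \<Longrightarrow> mid K p p n \<le> \<epsilon> * p n"
      "\<And>n j. n \<ge> N0 \<Longrightarrow> j \<ge> n - K \<Longrightarrow> p j \<le> C * p n"
      "\<And>n. n \<ge> N0 \<Longrightarrow> low K p p n / p n < 1 + \<epsilon>"
    unfolding eventually_at_top_linorder by blast
  define N where "N = max N0 (max (2 * K + 1) (K + 1))"
  \<comment> \<open>Between \<open>K\<close> and \<open>N\<close> no asymptotic estimate is
    available, but \<open>p\<close> is positive on this finite window, so an l^1 bound becomes a
    multiple of \<open>p n\<close>.\<close>
  define C2 where "C2 = (\<Sum>n\<in>{K<..<N}. 1 / p n)"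
  have C2: "1 \<le> C2 * p n" if "K < n" "n < N" for n
  proof -
    have "1 / p n \<le> C2" unfolding C2_def
      using that by (intro member_le_sum) (auto simp: p_nonneg)
    then show ?thesis using K(3)[of n] that by (simp add: field_simps)
  qed
  have C2_0: "C2 \<ge> 0" unfolding C2_def by (intro sum_nonneg) (simp add: p_nonneg)
  \<comment> \<open>\<open>B0\<close> serves the start of the induction, \<open>C\<close> the range
    where the iterate has small argument, \<open>C2\<close> the finite window.\<close>
  define B where "B = B0 + ?g * (C + C2)"
  have B: "B \<ge> B0" "B \<ge> ?g * C" "B \<ge> ?g * C2" "B \<ge> 0"
    using B0 C C2_0 g0 by (auto simp: B_def algebra_simps add_increasing add_increasing2)
  have main: "\<bar>?D m n\<bar> \<le> B * (real m + 1) * \<rho> ^ m * p n" if "n > K" for m n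
    using that
  proof (induction m arbitrary: n)
    case 0
    have "\<bar>g n\<bar> \<le> B0 * p n" using K(2) 0 by simp
    also have "\<dots> \<le> B * p n" using B by (intro mult_right_mono p_nonneg)
    finally show ?case by simp
  next
    case (Suc m)
    let ?\<alpha> = "B * (real m + 1) * \<rho> ^ m"
    have \<alpha>0: "?\<alpha> \<ge> 0" using B \<rho> by simp
    have sD: "summable_int (?D m)" and nD: "sum_int (\<lambda>n. \<bar>?D m n\<bar>) \<le> \<theta> ^ m * ?g" for m
      using renewal_iterate_summable[OF g, of \<theta> m] \<theta> by auto
    have pn: "p n > 0" using K(3) Suc.prems by simp
    have \<theta>\<rho>: "\<theta> ^ j \<le> \<rho> ^ j" for j using \<theta> \<rho> by (intro power_mono) auto
    \<comment> \<open>The first term is \<rho> times the previous bound, the second an l^1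
      contribution decaying at rate \<theta> \<le> \<rho>. Adding one such term per step produces
      the factor m + 1.\<close>
    have "\<bar>?D (Suc m) n\<bar> \<le> \<rho> * ?\<alpha> * p n + B * \<rho> ^ Suc m * p n"
    proof (cases "n < N")
      case True
      have "\<bar>?D (Suc m) n\<bar> \<le> sum_int (\<lambda>n. \<bar>?D (Suc m) n\<bar>)" by (rule abs_le_sum_int[OF sD])
      also have "\<dots> \<le> \<theta> ^ Suc m * ?g" by (rule nD)
      also have "\<dots> \<le> \<rho> ^ Suc m * ?g" using g0 by (intro mult_right_mono \<theta>\<rho>)
      also have "\<dots> \<le> \<rho> ^ Suc m * ?g * (C2 * p n)"
        using mult_left_mono[OF C2[OF Suc.prems True], of "\<rho> ^ Suc m * ?g"] g0 \<rho> by simp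
      also have "\<dots> = \<rho> ^ Suc m * (?g * C2) * p n" by simp
      also have "\<dots> \<le> \<rho> ^ Suc m * B * p n"
        using B \<rho> pn by (intro mult_right_mono mult_left_mono) auto
      also have "\<dots> \<le> \<rho> * ?\<alpha> * p n + B * \<rho> ^ Suc m * p n"
        using \<alpha>0 \<rho> pn by simp
      finally show ?thesis .
    next
      case False
      then have nN: "n \<ge> N0" "n > 2 * K" by (auto simp: N_def)
      \<comment> \<open>From k \<le> K and n > 2K follows n - k > K, so the induction hypothesis
        applies to the iterate.\<close>
      have "\<bar>low K p (?D m) n\<bar> \<le> sum_int (\<lambda>k. \<bar>indicator {..K} k * (p k * ?D m (n - k))\<bar>)"
        unfolding low_def by (rule integral_abs_bound)
      also have "\<dots> \<le> sum_int (\<lambda>k. ?\<alpha> * (indicator {..K} k * (p k * p (n - k))))"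
      proof (rule integral_mono)
        show "summable_int (\<lambda>k. \<bar>indicator {..K} k * (p k * ?D m (n - k))\<bar>)"
          by (intro integrable_abs summable_int_indicator summable_int_conv_integrand p_summable sD)
        show "summable_int (\<lambda>k. ?\<alpha> * (indicator {..K} k * (p k * p (n - k))))"
          by (intro integrable_mult_right summable_int_indicator summable_int_conv_integrand p_summable)
        show "\<bar>indicator {..K} k * (p k * ?D m (n - k))\<bar>
           \<le> ?\<alpha> * (indicator {..K} k * (p k * p (n - k)))" for k
          using mult_left_mono[OF Suc.IH[of "n - k"] p_nonneg[of k]] p_nonneg[of k] nN
          by (auto simp: indicator_def abs_mult mult_ac)
      qed
      also have "\<dots> = ?\<alpha> * low K p p n" by (simp add: low_def)
      also have "\<dots> \<le> ?\<alpha> * ((1 + \<epsilon>) * p n)"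
        using N0(3)[OF nN(1)] pn by (intro mult_left_mono \<alpha>0) (simp add: field_simps)
      finally have L1: "\<bar>low K p (?D m) n\<bar> \<le> ?\<alpha> * ((1 + \<epsilon>) * p n)" .
      \<comment> \<open>The induction hypothesis says nothing about the iterate at k \<le> K; its
        l^1 norm is used instead, with \<open>p (n - k)\<close> bounded by
        \<open>C * p n\<close>.\<close>
      have "\<bar>low K (?D m) p n\<bar> \<le> sum_int (\<lambda>k. \<bar>indicator {..K} k * (?D m k * p (n - k))\<bar>)"
        unfolding low_def by (rule integral_abs_bound)
      also have "\<dots> \<le> sum_int (\<lambda>k. C * p n * \<bar>?D m k\<bar>)"
      proof (rule integral_mono)
        show "summable_int (\<lambda>k. \<bar>indicator {..K} k * (?D m k * p (n - k))\<bar>)"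
          by (intro integrable_abs summable_int_indicator summable_int_conv_integrand p_summable sD)
        show "summable_int (\<lambda>k. C * p n * \<bar>?D m k\<bar>)"
          by (intro integrable_mult_right integrable_abs sD)
        show "\<bar>indicator {..K} k * (?D m k * p (n - k))\<bar> \<le> C * p n * \<bar>?D m k\<bar>" for k
          using mult_left_mono[OF N0(2)[OF nN(1), of "n - k"], of "\<bar>?D m k\<bar>"] p_nonneg[of "n - k"] pn C
          by (auto simp: indicator_def abs_mult mult_ac)
      qed
      also have "\<dots> = C * p n * sum_int (\<lambda>k. \<bar>?D m k\<bar>)" by simp
      also have "\<dots> \<le> C * p n * (\<theta> ^ m * ?g)"
        using C pn by (intro mult_left_mono nD) auto
      finally have L2: "\<bar>low K (?D m) p n\<bar> \<le> C * p n * (\<theta> ^ m * ?g)" .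
      have "\<bar>mid K p (?D m) n\<bar> \<le> ?\<alpha> * mid K p p n"
        by (rule mid_bound[OF sD]) (rule Suc.IH)
      also have "\<dots> \<le> ?\<alpha> * (\<epsilon> * p n)" using N0(1) nN by (intro mult_left_mono \<alpha>0) auto
      finally have L3: "\<bar>mid K p (?D m) n\<bar> \<le> ?\<alpha> * (\<epsilon> * p n)" .
      have "\<bar>conv p (?D m) n\<bar> \<le> ?\<alpha> * ((1 + \<epsilon>) * p n) + C * p n * (\<theta> ^ m * ?g) + ?\<alpha> * (\<epsilon> * p n)"
        using L1 L2 L3 conv_split[OF p_summable sD[of m] nN(2)] by linarith
      then have "\<theta> * \<bar>conv p (?D m) n\<bar>
         \<le> \<theta> * (?\<alpha> * ((1 + \<epsilon>) * p n) + C * p n * (\<theta> ^ m * ?g) + ?\<alpha> * (\<epsilon> * p n))"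
        using \<theta> by (intro mult_left_mono) auto
      also have "\<dots> = \<rho> * ?\<alpha> * p n + (?g * C) * \<theta> ^ Suc m * p n"
        by (simp add: \<rho>_eq algebra_simps)
      also have "\<dots> \<le> \<rho> * ?\<alpha> * p n + B * \<rho> ^ Suc m * p n"
        using B \<theta> \<theta>\<rho>[of "Suc m"] pn
        by (intro add_left_mono mult_right_mono mult_mono) auto
      finally show ?thesis using \<theta> by (simp add: renewal_step_def[of \<theta> "?D m"] abs_mult)
    qed
    also have "\<dots> = B * (real (Suc m) + 1) * \<rho> ^ Suc m * p n"
      by (simp add: algebra_simps)
    finally show ?case .
  qed
  show ?thesis using \<rho>(1,2) main by blast
qed

text \<open>Tannery's theorem exchanges the limit in \<open>n\<close> with the sum over
  \<open>m\<close>. The majorant B (m + 1) \<rho>^m is summable as the derivative of a geometric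
  series.\<close>

lemma renewal_series_limit:
  assumes g: "summable_int g" and \<theta>: "0 < \<theta>" "\<theta> < 1"
    and lim: "((\<lambda>n. g n / p n) \<longlongrightarrow> 0) at_top"
    and G: "\<And>n. (\<lambda>m. (renewal_step \<theta> ^^ m) g n) sums G n"
  shows "\<exists>l. ((\<lambda>n. G n / p n) \<longlongrightarrow> l) at_top"
proof -
  obtain \<rho> K B where \<rho>: "0 < \<rho>" "\<rho> < 1" and
    bnd: "\<And>m n. n > K \<Longrightarrow> \<bar>(renewal_step \<theta> ^^ m) g n\<bar> \<le> B * (real m + 1) * \<rho> ^ m * p n"
    using renewal_iterate_bound[OF g \<theta> lim] by metis
  have "\<exists>d. \<forall>m. ((\<lambda>n. (renewal_step \<theta> ^^ m) g n / p n) \<longlongrightarrow> d m) at_top"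
    by (intro choice allI renewal_iterate_limit[OF g _ lim] less_imp_le \<theta>(1))
  then obtain d where d: "\<And>m. ((\<lambda>n. (renewal_step \<theta> ^^ m) g n / p n) \<longlongrightarrow> d m) at_top" by blast
  have "\<forall>\<^sub>F n in at_top. \<forall>m. norm ((renewal_step \<theta> ^^ m) g n / p n) \<le> B * ((real m + 1) * \<rho> ^ m)"
    using p_pos eventually_gt_at_top[of K]
  proof eventually_elim
    case (elim n)
    show ?case
    proof
      fix m show "norm ((renewal_step \<theta> ^^ m) g n / p n) \<le> B * ((real m + 1) * \<rho> ^ m)"
        using bnd[OF elim(2), of m] elim(1) by (simp add: abs_divide field_simps)
    qed
  qed
  then have bound: "\<forall>\<^sub>F (m, n) in at_top \<times>\<^sub>F at_top.
      norm ((renewal_step \<theta> ^^ m) g n / p n) \<le> B * ((real m + 1) * \<rho> ^ m)"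
    by (subst eventually_prod_filter)
       (rule exI[of _ "\<lambda>_. True"], rule exI, intro conjI, auto)
  have "summable (\<lambda>m. real (Suc m) * \<rho> ^ m)"
    using geometric_deriv_sums[of \<rho>] \<rho> by (auto intro: sums_summable)
  then have summ: "summable (\<lambda>m. B * ((real m + 1) * \<rho> ^ m))"
    by (intro summable_mult) (simp add: add.commute)
  have "((\<lambda>n. \<Sum>m. (renewal_step \<theta> ^^ m) g n / p n) \<longlongrightarrow> suminf d) at_top"
    using tannerys_theorem[OF d bound summ] by simp
  moreover have "(\<Sum>m. (renewal_step \<theta> ^^ m) g n / p n) = G n / p n" for n
    using sums_unique[OF sums_divide[OF G[of n], of "p n"]] by simp
  ultimately show ?thesis by auto
qed

text \<open>The solution of \<open>G = g + \<theta> p * G\<close> need not be summable; the remainder \<open>\<theta>\<^sup>m p\<^sup>*\<^sup>m * G\<close> is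
  controlled by a supersolution \<open>w\<close>, which the iteration does not increase, and by constants,
  which it contracts.\<close>

lemma renewal_equation_limit:
  assumes g: "summable_int g" and \<theta>: "0 < \<theta>" "\<theta> < 1"
    and lim: "((\<lambda>n. g n / p n) \<longlongrightarrow> 0) at_top"
    and G_nonneg: "\<And>n. 0 \<le> G n"
    and G_eq: "\<And>n. G n = g n + renewal_step \<theta> G n"
    and w_pos: "\<And>n. 0 < w n"
    and w_summable: "\<And>n. summable_int (\<lambda>k. p k * w (n - k))"
    and w_super: "\<And>n. renewal_step \<theta> w n \<le> w n"
    and G_bound: "\<And>\<epsilon>. \<epsilon> > 0 \<Longrightarrow> \<exists>B. \<forall>n. G n \<le> \<epsilon> * w n + B"
  shows "\<exists>l. ((\<lambda>n. G n / p n) \<longlongrightarrow> l) at_top"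
proof (rule renewal_series_limit[OF g \<theta> lim])
  fix n
  let ?D = "\<lambda>m. (renewal_step \<theta> ^^ m) g" and ?R = "\<lambda>m. (renewal_step \<theta> ^^ m) G"
  have R_bound: "0 \<le> ?R m n \<and> ?R m n \<le> \<epsilon> * w n + \<theta> ^ m * B"
    and R_summable: "summable_int (\<lambda>k. p k * ?R m (n - k))"
    if \<epsilon>: "\<epsilon> > 0" and B: "\<And>n. G n \<le> \<epsilon> * w n + B" for \<epsilon> B m n
  proof -
    \<comment> \<open>This majorant gives \<open>conv p (?R m)\<close> a meaning although the
      iterate itself need not be summable.\<close>
    have dom: "summable_int (\<lambda>k. p k * (\<epsilon> * w (n - k) + \<theta> ^ m * B))" for n m
    proof -
      have "summable_int (\<lambda>k. \<epsilon> * (p k * w (n - k)) + \<theta> ^ m * B * p k)"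
        by (intro Bochner_Integration.integrable_add integrable_mult_right w_summable p_summable)
      then show ?thesis by (simp add: algebra_simps)
    qed
    have R_sum: "summable_int (\<lambda>k. p k * ?R m (n - k))"
      if "\<And>n. 0 \<le> ?R m n \<and> ?R m n \<le> \<epsilon> * w n + \<theta> ^ m * B" for m n
    proof (rule Bochner_Integration.integrable_bound[OF dom[of n m]])
      have "\<bar>p k * ?R m (n - k)\<bar> \<le> \<bar>p k * (\<epsilon> * w (n - k) + \<theta> ^ m * B)\<bar>" for k
        using that[of "n - k"] p_nonneg[of k] by (simp add: abs_mult mult_left_mono)
      then show "AE k in count_space UNIV. norm (p k * ?R m (n - k))
          \<le> norm (p k * (\<epsilon> * w (n - k) + \<theta> ^ m * B))" by simp
    qed simp
    have *: "0 \<le> ?R m n \<and> ?R m n \<le> \<epsilon> * w n + \<theta> ^ m * B" for m n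
    proof (induction m arbitrary: n)
      case 0 then show ?case using B G_nonneg by simp
    next
      case (Suc m)
      have 1: "0 \<le> conv p (?R m) n"
        unfolding conv_def using Suc.IH p_nonneg by (intro integral_nonneg_AE) simp
      have "conv p (?R m) n \<le> sum_int (\<lambda>k. p k * (\<epsilon> * w (n - k) + \<theta> ^ m * B))"
        unfolding conv_def using Suc.IH p_nonneg
        by (intro integral_mono R_sum dom mult_left_mono) auto
      also have "\<dots> = sum_int (\<lambda>k. \<epsilon> * (p k * w (n - k)) + \<theta> ^ m * B * p k)"
        by (simp add: algebra_simps)
      also have "\<dots> = \<epsilon> * conv p w n + \<theta> ^ m * B"
        by (subst Bochner_Integration.integral_add)
           (auto simp: p_sum conv_def intro!: integrable_mult_right w_summable p_summable)
      finally have "\<theta> * conv p (?R m) n \<le> \<theta> * (\<epsilon> * conv p w n + \<theta> ^ m * B)"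
        using \<theta> by (intro mult_left_mono) auto
      also have "\<dots> \<le> \<epsilon> * w n + \<theta> ^ Suc m * B"
        using mult_left_mono[OF w_super[of n], of \<epsilon>] \<epsilon> by (simp add: renewal_step_def algebra_simps)
      finally show ?case using 1 \<theta> by (simp add: renewal_step_def[of \<theta> "?R m"])
    qed
    show "0 \<le> ?R m n \<and> ?R m n \<le> \<epsilon> * w n + \<theta> ^ m * B" by (rule *)
    show "summable_int (\<lambda>k. p k * ?R m (n - k))" by (rule R_sum[OF *])
  qed
  have Rs: "summable_int (\<lambda>k. p k * ?R m (n - k))" for m n
    using G_bound[of 1] R_summable[of 1] by auto
  \<comment> \<open>The equation with the operator applied \<open>m\<close> times; splitting the
    convolution requires both parts to be summable.\<close>
  have step: "?R m n = ?D m n + ?R (Suc m) n" for m n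
  proof (induction m arbitrary: n)
    case 0 then show ?case using G_eq[of n] by simp
  next
    case (Suc m)
    have "conv p (?R m) n = conv p (?D m) n + conv p (?R (Suc m)) n"
    proof -
      have "conv p (?R m) n = sum_int (\<lambda>k. p k * ?D m (n - k) + p k * ?R (Suc m) (n - k))"
        unfolding conv_def by (subst Suc.IH) (simp add: algebra_simps)
      also have "\<dots> = conv p (?D m) n + conv p (?R (Suc m)) n"
        unfolding conv_def using \<theta>
        by (intro Bochner_Integration.integral_add Rs summable_int_conv_integrand p_summable
            renewal_iterate_summable(1) g) auto
      finally show ?thesis .
    qed
    then show ?case
      by (simp add: renewal_step_def[of \<theta> "?R m"] renewal_step_def[of \<theta> "?D m"]
          renewal_step_def[of \<theta> "renewal_step \<theta> (?R m)"] algebra_simps)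
  qed
  have partial: "(\<Sum>i<m. ?D i n) = G n - ?R m n" for m
  proof (induction m)
    case (Suc m) then show ?case using step[of m n] by simp
  qed simp
  have "(\<lambda>m. ?R m n) \<longlonglongrightarrow> 0"
  proof (rule LIMSEQ_I)
    fix r :: real assume r: "r > 0"
    \<comment> \<open>\<open>n\<close> is fixed, so \<epsilon> may depend on \<open>w n\<close>. The
      constant \<open>B\<close> depends on \<epsilon>, but \<theta>^m removes it.\<close>
    define \<epsilon> where "\<epsilon> = r / (2 * w n)"
    have \<epsilon>: "\<epsilon> > 0" using r w_pos by (simp add: \<epsilon>_def)
    then obtain B where B: "\<And>n. G n \<le> \<epsilon> * w n + B" using G_bound by blast
    have "(\<lambda>m. \<theta> ^ m * B) \<longlonglongrightarrow> 0" using \<theta> by (intro tendsto_mult_left_zero LIMSEQ_realpow_zero) auto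
    then have "\<forall>\<^sub>F m in sequentially. \<theta> ^ m * B < r / 2" by (rule order_tendstoD) (use r in simp)
    then obtain m0 where "\<And>m. m \<ge> m0 \<Longrightarrow> \<theta> ^ m * B < r / 2"
      unfolding eventually_sequentially by blast
    moreover have "0 \<le> ?R m n \<and> ?R m n \<le> r / 2 + \<theta> ^ m * B" for m
      using R_bound[OF \<epsilon> B, of m n] w_pos[of n] by (simp add: \<epsilon>_def)
    ultimately show "\<exists>m0. \<forall>m\<ge>m0. norm (?R m n - 0) < r"
      by (intro exI[of _ m0]) (smt (verit, best) field_sum_of_halves real_norm_def)
  qed
  from tendsto_diff[OF tendsto_const this, of "G n"]
  show "(\<lambda>m. ?D m n) sums G n"
    unfolding sums_def partial by simp
qed

end

section \<open>Limits along a dense set of scales\<close>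

text \<open>Tonelli on a piece of a fundamental domain of the dilation by exp h. The weight exp (n
  h) is the Jacobian of y = x exp (n h), so integrating the sum over x gives the integral of \<phi>
  over disjoint intervals. This is finite, so the sum cannot be infinite everywhere.\<close>

lemma exists_summable_scaling:
  fixes \<phi> :: "real \<Rightarrow> ennreal"
  assumes [measurable]: "\<phi> \<in> borel_measurable borel"
    and fin: "(\<integral>\<^sup>+y. indicator {0<..} y * \<phi> y \<partial>lborel) < \<infinity>"
    and "0 < a" "a < b" "0 < h"
  shows "\<exists>x. a < x \<and> x < b \<and> (\<Sum>n. ennreal (exp (real n * h)) * \<phi> (x * exp (real n * h))) < \<infinity>"
proof (rule ccontr)
  \<comment> \<open>Capping at a exp h makes the dilates of (a, c) disjoint.\<close>
  define c where "c = min b (a * exp h)"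
  define S where "S = (\<lambda>x. \<Sum>n. ennreal (exp (real n * h)) * \<phi> (x * exp (real n * h)))"
  define I where "I = (\<lambda>n::nat. {a * exp (real n * h)<..<c * exp (real n * h)})"
  have c: "a < c" "c \<le> b" "c \<le> a * exp h"
    using assms by (auto simp: c_def)
  assume neg: "\<not> ?thesis"
  have inf: "S x = \<infinity>" if "a < x" "x < c" for x
  proof -
    have "x < b" using that c by simp
    with neg that have "\<not> S x < \<infinity>" unfolding S_def by blast
    then show ?thesis by (simp add: less_top[symmetric])
  qed
  have disj: "disjoint_family I"
  proof -
    have "I m \<inter> I n = {}" if "m < n" for m n
    proof -
      have "c * exp (real m * h) \<le> a * exp h * exp (real m * h)"
        using c by (intro mult_right_mono) auto
      also have "\<dots> = a * exp (real (Suc m) * h)"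
        by (simp add: exp_add[symmetric] algebra_simps)
      also have "\<dots> \<le> a * exp (real n * h)"
        using that assms by (intro mult_left_mono) auto
      finally show ?thesis by (auto simp: I_def)
    qed
    then show ?thesis unfolding disjoint_family_on_def by (metis Int_commute linorder_neqE_nat)
  qed
  have "(\<integral>\<^sup>+x. indicator {a<..<c} x * S x \<partial>lborel)
      = (\<integral>\<^sup>+x. (\<Sum>n. indicator {a<..<c} x * (ennreal (exp (real n * h)) * \<phi> (x * exp (real n * h)))) \<partial>lborel)"
    by (simp add: S_def)
  also have "\<dots> = (\<Sum>n. \<integral>\<^sup>+x. indicator {a<..<c} x * (ennreal (exp (real n * h)) * \<phi> (x * exp (real n * h))) \<partial>lborel)"
    by (rule nn_integral_suminf) simp
  also have "\<dots> = (\<Sum>n. \<integral>\<^sup>+y. indicator (I n) y * \<phi> y \<partial>lborel)"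
  proof (rule suminf_cong)
    fix n
    let ?e = "exp (real n * h)"
    have "(\<integral>\<^sup>+y. indicator (I n) y * \<phi> y \<partial>lborel)
        = ennreal \<bar>?e\<bar> * (\<integral>\<^sup>+x. indicator (I n) (0 + ?e * x) * \<phi> (0 + ?e * x) \<partial>lborel)"
      by (rule nn_integral_real_affine) (auto simp: I_def)
    also have "\<dots> = (\<integral>\<^sup>+x. ennreal ?e * (indicator (I n) (0 + ?e * x) * \<phi> (0 + ?e * x)) \<partial>lborel)"
      by (subst nn_integral_cmult) (auto simp: I_def)
    also have "\<dots> = (\<integral>\<^sup>+x. indicator {a<..<c} x * (ennreal ?e * \<phi> (x * ?e)) \<partial>lborel)"
      by (intro nn_integral_cong) (auto simp: I_def indicator_def mult_ac)
    finally show "(\<integral>\<^sup>+x. indicator {a<..<c} x * (ennreal ?e * \<phi> (x * ?e)) \<partial>lborel)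
      = (\<integral>\<^sup>+y. indicator (I n) y * \<phi> y \<partial>lborel)" ..
  qed
  also have "\<dots> = (\<integral>\<^sup>+y. (\<Sum>n. indicator (I n) y * \<phi> y) \<partial>lborel)"
    by (rule nn_integral_suminf[symmetric]) (auto simp: I_def)
  also have "\<dots> = (\<integral>\<^sup>+y. indicator (\<Union>n. I n) y * \<phi> y \<partial>lborel)"
    by (simp add: suminf_indicator[OF disj])
  also have "\<dots> \<le> (\<integral>\<^sup>+y. indicator {0<..} y * \<phi> y \<partial>lborel)"
  proof (intro nn_integral_mono mult_right_mono)
    have "y > 0" if "y \<in> I n" for y n
      using that assms by (auto simp: I_def intro: less_trans[rotated])
    then show "indicator (\<Union>n. I n) y \<le> (indicator {0<..} y :: ennreal)" for y
      by (auto simp: indicator_def)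
  qed simp
  also note fin
  finally have "(\<integral>\<^sup>+x. indicator {a<..<c} x * S x \<partial>lborel) < \<infinity>" .
  moreover have "(\<integral>\<^sup>+x. indicator {a<..<c} x * S x \<partial>lborel) = (\<integral>\<^sup>+x. \<infinity> * indicator {a<..<c} x \<partial>lborel)"
    by (intro nn_integral_cong) (auto simp: indicator_def inf)
  moreover have "\<dots> = \<infinity>"
    using c by (subst nn_integral_cmult_indicator) (auto simp: ennreal_top_mult)
  ultimately show False by simp
qed

text \<open>Helly's argument for monotone functions. \<open>H_shift\<close> trades a dilation by exp
  h for the index n + 1; in the limit, with r n -> 1, this becomes the periodicity of x^\<kappa>
  times the limit.\<close>

lemma log_periodic_limit:
  fixes H :: "nat \<Rightarrow> real \<Rightarrow> real"
  assumes "h > 0"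
    and H_nonneg: "\<forall>\<^sub>F n in sequentially. \<forall>x>0. 0 \<le> H n x"
    and H_antimono: "\<forall>\<^sub>F n in sequentially. \<forall>x y. 0 < x \<longrightarrow> x \<le> y \<longrightarrow> H n y \<le> H n x"
    and H_shift: "\<And>x. x > 0 \<Longrightarrow>
        \<forall>\<^sub>F n in sequentially. H n (x * exp h) = exp (-\<kappa> * h) * (r n * H (Suc n) x)"
    and r: "r \<longlonglongrightarrow> 1"
    and dense: "\<And>a b. 0 < a \<Longrightarrow> a < b \<Longrightarrow> \<exists>x. a < x \<and> x < b \<and> convergent (\<lambda>n. H n x)"
  shows "\<exists>q \<in> log_periodic_class \<kappa> h. \<forall>x \<in> continuity_points q. (\<lambda>n. x powr \<kappa> * H n x) \<longlonglongrightarrow> q x"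
proof -
  define D where "D = {x. x > 0 \<and> convergent (\<lambda>n. H n x)}"
  define L where "L x = lim (\<lambda>n. H n x)" for x
  \<comment> \<open>The left limit of the nonincreasing \<open>L\<close>. It may differ from
    \<open>L\<close> at points of \<open>D\<close>, but not where \<open>J\<close> is
    continuous.\<close>
  define J where "J x = Inf (L ` (D \<inter> {..<x}))" for x
  define q where "q x = x powr \<kappa> * J x" for x
  have L: "(\<lambda>n. H n x) \<longlonglongrightarrow> L x" if "x \<in> D" for x
    using that convergent_LIMSEQ_iff by (auto simp: D_def L_def)
  have D_pos: "x > 0" if "x \<in> D" for x using that by (simp add: D_def)
  have D_dense: "\<exists>x\<in>D. a < x \<and> x < b" if "0 < a" "a < b" for a b
  proof -
    obtain x where "a < x" "x < b" "convergent (\<lambda>n. H n x)"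
      using dense[of a b] \<open>0 < a\<close> \<open>a < b\<close> by blast
    then show ?thesis using that by (intro bexI[of _ x]) (auto simp: D_def)
  qed
  have L_nonneg: "0 \<le> L x" if "x \<in> D" for x
  proof (rule tendsto_lowerbound[OF L[OF that]])
    show "\<forall>\<^sub>F n in sequentially. 0 \<le> H n x"
      using H_nonneg by eventually_elim (use D_pos[OF that] in simp)
  qed simp
  have L_antimono: "L y \<le> L x" if "x \<in> D" "y \<in> D" "x \<le> y" for x y
  proof (rule tendsto_le[OF _ L[OF that(1)] L[OF that(2)]])
    show "\<forall>\<^sub>F n in sequentially. H n y \<le> H n x"
      using H_antimono by eventually_elim (use D_pos that in simp)
  qed simp
  \<comment> \<open>The set is nonempty by density and bounded below by 0, so the infimum is genuine
    and can be handled through its lower bounds.\<close>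
  have J_ge_iff: "c \<le> J x \<longleftrightarrow> (\<forall>y\<in>D. y < x \<longrightarrow> c \<le> L y)" if "x > 0" for c x
  proof -
    have "D \<inter> {..<x} \<noteq> {}"
      using D_dense[of "x / 2" x] that by auto
    moreover have "bdd_below (L ` (D \<inter> {..<x}))"
      by (rule bdd_belowI[of _ 0]) (use L_nonneg in auto)
    ultimately show ?thesis unfolding J_def by (subst le_cInf_iff) auto
  qed
  have J_le: "J x \<le> L y" if "y \<in> D" "y < x" for x y
    using J_ge_iff[of x "J x"] that D_pos[OF that(1)] by auto
  have J_ge: "L y \<le> J x" if "y \<in> D" "0 < x" "x \<le> y" for x y
    using J_ge_iff[of x "L y"] that L_antimono[of _ y] by auto
  have J_antimono: "J y \<le> J x" if "0 < x" "x \<le> y" for x y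
    using J_ge_iff[OF that(1), of "J y"] J_le[of _ y] that by auto
  have shift: "(x * exp h \<in> D \<longleftrightarrow> x \<in> D) \<and> (x \<in> D \<longrightarrow> L (x * exp h) = exp (-\<kappa> * h) * L x)"
    if x: "x > 0" for x
  proof -
    have 1: "(\<lambda>n. H n (x * exp h)) \<longlonglongrightarrow> exp (-\<kappa> * h) * L x" if "x \<in> D"
    proof (rule Lim_transform_eventually)
      show "\<forall>\<^sub>F n in sequentially. exp (-\<kappa> * h) * (r n * H (Suc n) x) = H n (x * exp h)"
        using H_shift[OF x] by eventually_elim simp
      have "(\<lambda>n. exp (-\<kappa> * h) * (r n * H (Suc n) x)) \<longlonglongrightarrow> exp (-\<kappa> * h) * (1 * L x)"
        by (intro tendsto_mult tendsto_const r LIMSEQ_Suc L that)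
      then show "(\<lambda>n. exp (-\<kappa> * h) * (r n * H (Suc n) x)) \<longlonglongrightarrow> exp (-\<kappa> * h) * L x" by simp
    qed
    \<comment> \<open>For the converse the shift relation is solved for the term with index n + 1,
      which is possible once r n > 0.\<close>
    have 2: "x \<in> D" if "x * exp h \<in> D"
    proof -
      have "(\<lambda>n. exp (\<kappa> * h) * (H n (x * exp h) / r n)) \<longlonglongrightarrow> exp (\<kappa> * h) * (L (x * exp h) / 1)"
        by (intro tendsto_mult tendsto_const tendsto_divide r L that) simp
      moreover have "\<forall>\<^sub>F n in sequentially. r n > 0" using r by (rule order_tendstoD) simp
      with H_shift[OF x]
      have "\<forall>\<^sub>F n in sequentially. exp (\<kappa> * h) * (H n (x * exp h) / r n) = H (Suc n) x"
        by eventually_elim (simp add: exp_minus field_simps)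
      ultimately have "(\<lambda>n. H (Suc n) x) \<longlonglongrightarrow> exp (\<kappa> * h) * (L (x * exp h) / 1)"
        by (rule Lim_transform_eventually)
      then have "(\<lambda>n. H n x) \<longlonglongrightarrow> exp (\<kappa> * h) * (L (x * exp h) / 1)"
        by (rule LIMSEQ_imp_Suc)
      then show ?thesis using x by (auto simp: D_def convergent_def)
    qed
    show ?thesis using 1 2 x limI[OF 1] by (auto simp: D_def L_def convergent_def)
  qed
  have J_shift: "J (x * exp h) = exp (-\<kappa> * h) * J x" if x: "x > 0" for x
  proof -
    \<comment> \<open>Both sides are compared through their lower bounds; multiplication by exp h
      maps \<open>D\<close> onto itself.\<close>
    have "c \<le> J (x * exp h) \<longleftrightarrow> c * exp (\<kappa> * h) \<le> J x" for c
    proof -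
      have "c \<le> J (x * exp h) \<longleftrightarrow> (\<forall>y\<in>D. y < x * exp h \<longrightarrow> c \<le> L y)"
        using x by (intro J_ge_iff) simp
      also have "\<dots> \<longleftrightarrow> (\<forall>y\<in>D. y < x \<longrightarrow> c \<le> exp (-\<kappa> * h) * L y)"
      proof safe
        fix y assume *: "\<forall>y\<in>D. y < x * exp h \<longrightarrow> c \<le> L y" and y: "y \<in> D" "y < x"
        then have "y * exp h \<in> D" "y * exp h < x * exp h" using shift[of y] D_pos[of y] by auto
        then show "c \<le> exp (-\<kappa> * h) * L y" using * shift[of y] D_pos[of y] y by metis
      next
        fix y assume *: "\<forall>y\<in>D. y < x \<longrightarrow> c \<le> exp (-\<kappa> * h) * L y" and y: "y \<in> D" "y < x * exp h"
        define z where "z = y * exp (-h)"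
        have z: "y = z * exp h" "z > 0" using D_pos[OF y(1)] by (auto simp: z_def exp_minus)
        then have "z \<in> D" "z < x" using shift[of z] y by auto
        then show "c \<le> L y" using * shift[of z] z by auto
      qed
      also have "\<dots> \<longleftrightarrow> (\<forall>y\<in>D. y < x \<longrightarrow> c * exp (\<kappa> * h) \<le> L y)"
        by (simp add: exp_minus field_simps)
      also have "\<dots> \<longleftrightarrow> c * exp (\<kappa> * h) \<le> J x"
        using x by (intro J_ge_iff[symmetric])
      finally show ?thesis .
    qed
    from this[of "J (x * exp h)"] this[of "exp (-\<kappa> * h) * J x"] show ?thesis
      by (simp add: exp_minus field_simps)
  qed
  have "q \<in> log_periodic_class \<kappa> h"
    unfolding log_periodic_class_def
  proof (intro CollectI conjI allI impI)
    show "0 \<le> q x" if "0 < x" for x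
      using J_ge_iff[OF that, of 0] L_nonneg by (auto simp: q_def)
    show "antimono_on {0<..} (\<lambda>x. x powr (-\<kappa>) * q x)"
    proof (rule monotone_onI)
      fix x y :: real assume "x \<in> {0<..}" "y \<in> {0<..}" "x \<le> y"
      then show "y powr - \<kappa> * q y \<le> x powr - \<kappa> * q x"
        using J_antimono[of x y] by (simp add: q_def powr_minus field_simps)
    qed
    show "q (x * exp h) = q x" if "0 < x" for x
    proof -
      have "(x * exp h) powr \<kappa> = x powr \<kappa> * exp (\<kappa> * h)"
        using that by (simp add: powr_mult exp_powr_real mult.commute)
      then show ?thesis by (simp add: q_def J_shift[OF that] exp_minus)
    qed
  qed
  moreover have "(\<lambda>n. x powr \<kappa> * H n x) \<longlonglongrightarrow> q x" if "x \<in> continuity_points q" for x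
  proof -
    have x: "x > 0" and cq: "isCont q x" using that by (auto simp: continuity_points_def)
    have "isCont (\<lambda>u. u powr (-\<kappa>) * q u) x"
      using cq x by (intro continuous_intros) auto
    moreover have "\<forall>\<^sub>F u in nhds x. u powr (-\<kappa>) * q u = J u"
      using order_tendstoD(1)[OF filterlim_ident x]
      by eventually_elim (simp add: q_def powr_minus field_simps)
    ultimately have cJ: "isCont J x" by (simp cong: isCont_cong)
    \<comment> \<open>A point of \<open>D\<close> slightly to the right of x bounds H n x from below
      and one slightly to the left bounds it from above; continuity of \<open>J\<close> brings both
      bounds close to J x.\<close>
    have "(\<lambda>n. H n x) \<longlonglongrightarrow> J x"
    proof (rule order_tendstoI)
      fix c assume "c < J x"
      then have "\<forall>\<^sub>F u in at x. c < J u"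
        using cJ by (intro order_tendstoD(1)[of J "J x"]) (simp_all add: isCont_def)
      then obtain e where e: "e > 0" "\<And>u. u \<noteq> x \<Longrightarrow> dist u x < e \<Longrightarrow> c < J u"
        unfolding eventually_at by auto
      obtain z where z: "z \<in> D" "x < z" "z < x + e / 2"
        using D_dense[of x "x + e / 2"] x e by auto
      have "c < J (x + e / 2)" using e by (intro e(2)) (auto simp: dist_real_def)
      also have "\<dots> \<le> L z" using z by (intro J_le) auto
      finally have "\<forall>\<^sub>F n in sequentially. c < H n z" using L[OF z(1)] by (intro order_tendstoD(1))
      with H_antimono show "\<forall>\<^sub>F n in sequentially. c < H n x"
      proof eventually_elim
        case (elim n)
        then have "H n z \<le> H n x" using x z(2) by simp
        with elim show ?case by linarith
      qed
    next
      fix c assume "J x < c"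
      then have "\<forall>\<^sub>F u in at x. J u < c"
        using cJ by (intro order_tendstoD(2)[of J "J x"]) (simp_all add: isCont_def)
      then obtain e where e: "e > 0" "\<And>u. u \<noteq> x \<Longrightarrow> dist u x < e \<Longrightarrow> J u < c"
        unfolding eventually_at by auto
      define u where "u = max (x / 2) (x - e / 2)"
      have u: "0 < u" "u < x" "dist u x < e" using x e by (auto simp: u_def dist_real_def)
      obtain y where y: "y \<in> D" "u < y" "y < x" using D_dense[of u x] u by auto
      have "L y \<le> J u" using u y by (intro J_ge) auto
      also have "\<dots> < c" using u by (intro e(2)) auto
      finally have "\<forall>\<^sub>F n in sequentially. H n y < c" using L[OF y(1)] by (intro order_tendstoD(2))
      with H_antimono show "\<forall>\<^sub>F n in sequentially. H n x < c"
      proof eventually_elim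
        case (elim n)
        then have "H n x \<le> H n y" using D_pos[OF y(1)] y(3) by simp
        with elim show ?case by linarith
      qed
    qed
    from tendsto_mult[OF tendsto_const this, of "x powr \<kappa>"] show ?thesis by (simp add: q_def)
  qed
  ultimately show ?thesis by blast
qed

section \<open>Lattice distributions\<close>

text \<open>On the lattice \<phi> y is a sum with at most one nonzero term, since h > 0 makes the
  lattice points distinct; exchanging sum and integral exhibits the atoms.\<close>

lemma nn_integral_lattice:
  fixes \<phi> :: "real \<Rightarrow> ennreal"
  assumes N: "concentrated_on_lattice N h" and [measurable_cong]: "sets N = sets borel"
    and [measurable]: "\<phi> \<in> borel_measurable borel"
  shows "(\<integral>\<^sup>+y. \<phi> y \<partial>N) = (\<integral>\<^sup>+k. \<phi> (of_int k * h) * emeasure N {of_int k * h} \<partial>count_space UNIV)"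
proof -
  have h: "h > 0" and AE: "AE y in N. y \<in> range (\<lambda>k::int. of_int k * h)"
    using N by (auto simp: concentrated_on_lattice_def)
  have "(\<integral>\<^sup>+y. \<phi> y \<partial>N)
      = (\<integral>\<^sup>+y. \<integral>\<^sup>+k. \<phi> (of_int k * h) * indicator {of_int k * h} y \<partial>count_space UNIV \<partial>N)"
  proof (rule nn_integral_cong_AE)
    show "AE y in N. \<phi> y = (\<integral>\<^sup>+k. \<phi> (of_int k * h) * indicator {of_int k * h} y \<partial>count_space UNIV)"
      using AE
    proof eventually_elim
      case (elim y)
      then obtain k0 :: int where k0: "y = of_int k0 * h" by auto
      have "(\<integral>\<^sup>+k. \<phi> (of_int k * h) * indicator {of_int k * h} y \<partial>count_space UNIV)
          = (\<Sum>k\<in>{k0}. \<phi> (of_int k * h) * indicator {of_int k * h} y)"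
        using h by (intro nn_integral_count_space') (auto simp: k0 indicator_def)
      then show ?case by (simp add: k0)
    qed
  qed
  also have "\<dots> = (\<integral>\<^sup>+k. \<integral>\<^sup>+y. \<phi> (of_int k * h) * indicator {of_int k * h} y \<partial>N \<partial>count_space UNIV)"
    by (rule nn_integral_count_space_nn_integral) auto
  also have "\<dots> = (\<integral>\<^sup>+k. \<phi> (of_int k * h) * emeasure N {of_int k * h} \<partial>count_space UNIV)"
    using assms(2) by (intro nn_integral_cong nn_integral_cmult_indicator) auto
  finally show ?thesis .
qed

lemma (in finite_borel_measure) lattice_mass_cdf:
  "lattice_mass h (cdf M) k = measure M {of_int k * h}"
proof -
  let ?x = "of_int k * h"
  have "Lim (at_left ?x) (cdf M) = measure M {..<?x}"
    by (intro tendsto_Lim cdf_at_left) simp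
  moreover have "measure M {..?x} = measure M {..<?x} + measure M {?x}"
    by (subst finite_measure_Union[symmetric]) (auto intro!: arg_cong[where f = "measure M"])
  ultimately show ?thesis by (simp add: lattice_mass_def jump_def cdf_def)
qed

text \<open>It lets \<open>df_convolution (cdf N) (cdf N)\<close> be read as the distribution
  function of the convolution of \<open>N\<close> with itself.\<close>

lemma (in real_distribution) interval_measure_cdf: "interval_measure (cdf M) = M"
proof (rule cdf_unique)
  show "real_distribution (interval_measure (cdf M))"
    by (intro real_distribution_interval_measure cdf_nondecreasing cdf_is_right_cont
        cdf_lim_at_bot cdf_lim_at_top_prob)
  show "real_distribution M" ..
  show "cdf (interval_measure (cdf M)) = cdf M"
    by (intro cdf_interval_measure cdf_nondecreasing cdf_is_right_cont cdf_lim_at_bot)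
qed

lemma local_subexponential_lattice_mass:
  assumes N: "real_distribution N" and lat: "concentrated_on_lattice N h"
    and ratio: "(\<lambda>n::nat. lattice_mass h (cdf N) (int n + 1) / lattice_mass h (cdf N) (int n)) \<longlonglongrightarrow> 1"
    and conv: "(\<lambda>n::nat. lattice_mass h (df_convolution (cdf N) (cdf N)) (int n)
                 / lattice_mass h (cdf N) (int n)) \<longlonglongrightarrow> 2"
    and tail: "(\<lambda>n::nat. SUP k\<in>{int n..}. lattice_mass h (cdf N) k)
                 \<in> O(\<lambda>n. lattice_mass h (cdf N) (int n))"
  shows "local_subexponential (lattice_mass h (cdf N))"
proof -
  interpret N: real_distribution N by fact
  let ?p = "lattice_mass h (cdf N)"
  have p: "?p k = measure N {of_int k * h}" for k by (rule N.lattice_mass_cdf)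
  have ep: "emeasure N {of_int k * h} = ennreal (?p k)" for k
    unfolding p by (rule N.emeasure_eq_measure)
  have nonneg: "0 \<le> ?p k" for k unfolding p by simp
  have nn1: "(\<integral>\<^sup>+k. ennreal (?p k) \<partial>count_space UNIV) = 1"
    using nn_integral_lattice[OF lat N.events_eq_borel, of "\<lambda>_. 1"] N.emeasure_space_1 by (simp add: ep)
  have summ: "summable_int ?p"
    by (rule integrableI_nonneg) (auto simp: nn1 nonneg)
  have "ennreal (sum_int ?p) = 1"
    using nn_integral_eq_integral[OF summ] nonneg nn1 by simp
  then have sum1: "sum_int ?p = 1" by simp
  have fin: "finite_measure (N \<star> N)"
    by (rule convolution_finite) (auto intro: N.finite_measure_axioms)
  then interpret NN: finite_borel_measure "N \<star> N"
    by (intro finite_borel_measure.intro finite_borel_measure_axioms.intro) auto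
  have "lattice_mass h (df_convolution (cdf N) (cdf N)) n = conv ?p ?p n" for n
  proof -
    have nonneg_int: "0 \<le> conv ?p ?p n"
      unfolding conv_def by (intro integral_nonneg_AE) (simp add: nonneg)
    have "emeasure (N \<star> N) {of_int n * h} = (\<integral>\<^sup>+x. emeasure N {a. a + x \<in> {of_int n * h}} \<partial>N)"
      by (rule convolution_emeasure) (auto intro: N.finite_measure_axioms)
    also have "\<dots> = (\<integral>\<^sup>+x. emeasure N {of_int n * h - x} \<partial>N)"
      by (intro nn_integral_cong arg_cong2[where f = emeasure]) auto
    also have "\<dots> = (\<integral>\<^sup>+k. emeasure N {of_int n * h - of_int k * h} * emeasure N {of_int k * h} \<partial>count_space UNIV)"
    proof (rule nn_integral_lattice[OF lat N.events_eq_borel])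
      \<comment> \<open>The mass of a moving point is the measure of a fibre of a line in the plane,
        hence measurable.\<close>
      have "(\<lambda>x. emeasure N (Pair x -` {z \<in> space (borel \<Otimes>\<^sub>M N). snd z = of_int n * h - fst z}))
           \<in> borel_measurable borel"
        by (rule N.measurable_emeasure_Pair) measurable
      then show "(\<lambda>x. emeasure N {of_int n * h - x}) \<in> borel_measurable borel"
        by (rule measurable_cong[THEN iffD1, rotated])
           (auto intro!: arg_cong2[where f = emeasure] simp: space_pair_measure)
    qed
    also have "\<dots> = (\<integral>\<^sup>+k. ennreal (?p k * ?p (n - k)) \<partial>count_space UNIV)"
    proof (rule nn_integral_cong)
      fix k
      have "of_int n * h - of_int k * h = of_int (n - k) * h" by (simp add: algebra_simps)
      then show "emeasure N {of_int n * h - of_int k * h} * emeasure N {of_int k * h}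
          = ennreal (?p k * ?p (n - k))"
        by (simp only: ep ennreal_mult[OF nonneg nonneg]) (rule mult.commute)
    qed
    also have "\<dots> = ennreal (conv ?p ?p n)"
      unfolding conv_def
      by (intro nn_integral_eq_integral summable_int_conv_integrand summ) (simp add: nonneg)
    finally show ?thesis
      using nonneg_int
      by (simp add: df_convolution_def N.interval_measure_cdf NN.lattice_mass_cdf NN.emeasure_eq_measure)
  qed
  note conv_eq = this
  show ?thesis
  proof
    show "((\<lambda>n. ?p (n + 1) / ?p n) \<longlongrightarrow> 1) at_top"
      using ratio by (simp add: tendsto_int_at_top_iff)
    show "((\<lambda>n. conv ?p ?p n / ?p n) \<longlongrightarrow> 2) at_top"
      using conv by (simp add: tendsto_int_at_top_iff conv_eq)
    obtain C where C: "\<forall>\<^sub>F n in sequentially. norm (SUP k\<in>{int n..}. ?p k) \<le> C * norm (?p (int n))"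
      using tail by (elim landau_o.bigE)
    \<comment> \<open>A real supremum is known to dominate its set only when that set is bounded;
      here the masses are at most 1.\<close>
    have bdd: "bdd_above (?p ` {int n..})" for n
      by (rule bdd_aboveI[of _ 1]) (auto simp: p)
    have "\<forall>\<^sub>F n in sequentially. \<forall>k\<ge>int n. ?p k \<le> C * ?p (int n)"
      using C
    proof eventually_elim
      case (elim n)
      show ?case
      proof safe
        fix k assume "k \<ge> int n"
        then have "?p k \<le> (SUP k\<in>{int n..}. ?p k)" by (intro cSUP_upper bdd) auto
        also have "\<dots> \<le> C * ?p (int n)" using elim nonneg[of "int n"] by simp
        finally show "?p k \<le> C * ?p (int n)" .
      qed
    qed
    then show "\<exists>C. \<forall>\<^sub>F n in at_top. \<forall>k\<ge>n. ?p k \<le> C * ?p n"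
      by (auto simp: eventually_int_at_top_iff)
  qed (use nonneg summ sum1 in auto)
qed

section \<open>The tail of a solution\<close>

locale implicit_renewal = prob_space +
  fixes A X :: "'a \<Rightarrow> real" and \<kappa> h \<theta> \<delta> :: real and N :: "real measure" and p :: "int \<Rightarrow> real"
  assumes \<kappa>_pos: "\<kappa> > 0" and h_pos: "h > 0" and \<theta>_pos: "0 < \<theta>" and \<theta>_less_1: "\<theta> < 1"
    and \<delta>_pos: "\<delta> > 0"
    and A_measurable [measurable]: "A \<in> borel_measurable M"
    and X_measurable [measurable]: "X \<in> borel_measurable M"
    and A_nonneg: "AE \<omega> in M. A \<omega> \<ge> 0"
    and A_integrable: "integrable M (\<lambda>\<omega>. A \<omega> powr \<kappa>)"
    and A_moment: "(LINT \<omega>|M. A \<omega> powr \<kappa>) = \<theta>"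
    and indep: "indep_var borel X borel A"
    and N: "real_distribution N" "concentrated_on_lattice N h" "tilted_df M A \<kappa> = cdf N"
    and p: "\<And>k. p k = measure N {of_int k * h}"
    and p_subexp: "local_subexponential p"
    and integrable_diff: "set_integrable lborel {0<..}
           (\<lambda>y. y powr (\<kappa> + \<delta> - 1) *
              \<bar>measure M {\<omega> \<in> space M. X \<omega> > y} - measure M {\<omega> \<in> space M. A \<omega> * X \<omega> > y}\<bar>)"
begin

sublocale local_subexponential p by (rule p_subexp)

section \<open>Tails of X and AX, and the change of measure\<close>

definition tail :: "real \<Rightarrow> real" where
  "tail y = measure M {\<omega> \<in> space M. X \<omega> > y}"

definition tail_mult :: "real \<Rightarrow> real" where
  "tail_mult y = measure M {\<omega> \<in> space M. A \<omega> * X \<omega> > y}"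

lemma tail_bounds: "0 \<le> tail y" "tail y \<le> 1" "0 \<le> tail_mult y" "tail_mult y \<le> 1"
  by (auto simp: tail_def tail_mult_def)

lemma tail_antimono: "x \<le> y \<Longrightarrow> tail y \<le> tail x"
  unfolding tail_def by (intro finite_measure_mono) auto

lemma tail_mult_antimono: "x \<le> y \<Longrightarrow> tail_mult y \<le> tail_mult x"
  unfolding tail_mult_def by (intro finite_measure_mono) auto

lemma measurable_antimono:
  fixes f :: "real \<Rightarrow> real"
  assumes "\<And>x y. x \<le> y \<Longrightarrow> f y \<le> f x"
  shows "f \<in> borel_measurable borel"
proof -
  have "(\<lambda>x. - f x) \<in> borel_measurable borel"
    by (rule borel_measurable_mono) (use assms in \<open>auto simp: mono_def\<close>)
  then have "(\<lambda>x. - (- f x)) \<in> borel_measurable borel" by measurable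
  then show ?thesis by simp
qed

lemma tail_measurable [measurable]: "tail \<in> borel_measurable borel" "tail_mult \<in> borel_measurable borel"
  by (auto intro: measurable_antimono tail_antimono tail_mult_antimono)

lemma tail_tendsto_0: "(tail \<longlongrightarrow> 0) at_top"
proof -
  interpret D: real_distribution "distr M borel X" by simp
  have "((\<lambda>y. 1 - cdf (distr M borel X) y) \<longlongrightarrow> 1 - 1) at_top"
    by (intro tendsto_diff tendsto_const D.cdf_lim_at_top_prob)
  moreover have "1 - cdf (distr M borel X) y = tail y" for y
  proof -
    have "tail y = measure (distr M borel X) (space (distr M borel X) - {..y})"
      unfolding tail_def by (subst measure_distr) (auto intro!: arg_cong[where f = "measure M"])
    then show ?thesis by (subst (asm) D.prob_compl) (auto simp: cdf_def)
  qed
  ultimately show ?thesis by simp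
qed

text \<open>\<open>N\<close> becomes the law of log A under the probability with density A^\<kappa>
  / \<theta>. The density vanishes at A = 0, so the junk value \<open>ln 0\<close> carries no
  mass.\<close>

lemma tilted_law: "N = distr (density M (\<lambda>\<omega>. ennreal (A \<omega> powr \<kappa> / \<theta>))) borel (\<lambda>\<omega>. ln (A \<omega>))"
  (is "N = ?N1")
proof (rule cdf_unique)
  have em: "emeasure ?N1 S = ennreal ((LINT \<omega>|M. indicator {\<omega>. ln (A \<omega>) \<in> S} \<omega> * A \<omega> powr \<kappa>) / \<theta>)"
    if [measurable]: "S \<in> sets borel" for S
  proof -
    have "emeasure ?N1 S = (\<integral>\<^sup>+\<omega>. ennreal (A \<omega> powr \<kappa> / \<theta>) * indicator {\<omega>. ln (A \<omega>) \<in> S} \<omega> \<partial>M)"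
      by (subst emeasure_distr)
         (auto simp: emeasure_density vimage_def indicator_def intro!: nn_integral_cong)
    also have "\<dots> = (\<integral>\<^sup>+\<omega>. ennreal (indicator {\<omega>. ln (A \<omega>) \<in> S} \<omega> * A \<omega> powr \<kappa> / \<theta>) \<partial>M)"
      by (intro nn_integral_cong) (auto simp: indicator_def)
    also have "\<dots> = ennreal (LINT \<omega>|M. indicator {\<omega>. ln (A \<omega>) \<in> S} \<omega> * A \<omega> powr \<kappa> / \<theta>)"
    proof (intro nn_integral_eq_integral integrable_divide)
      show "integrable M (\<lambda>\<omega>. indicator {\<omega>. ln (A \<omega>) \<in> S} \<omega> * A \<omega> powr \<kappa>)"
        by (rule Bochner_Integration.integrable_bound[OF A_integrable]) (auto simp: indicator_def)
    qed (use \<theta>_pos in auto)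
    finally show ?thesis by simp
  qed
  have "emeasure ?N1 UNIV = 1" using em[of UNIV] A_moment \<theta>_pos by simp
  then interpret N1: real_distribution ?N1
    by (intro real_distribution.intro real_distribution_axioms.intro prob_spaceI) auto
  show "real_distribution ?N1" ..
  show "real_distribution N" by (rule N(1))
  have "cdf ?N1 x = tilted_df M A \<kappa> x" for x
    unfolding cdf_def measure_def using em[of "{..x}"] \<theta>_pos
    by (simp add: tilted_df_def A_moment integral_nonneg_AE)
  then show "cdf N = cdf ?N1" using N(3) by auto
qed

text \<open>Used with a factor exp (-\<kappa> y) in \<psi>, which undoes the tilt. Extended
  nonnegative values spare integrability conditions.\<close>

lemma nn_integral_tilted:
  assumes [measurable]: "\<psi> \<in> borel_measurable borel"
  shows "(\<integral>\<^sup>+\<omega>. ennreal (A \<omega> powr \<kappa>) * \<psi> (ln (A \<omega>)) \<partial>M)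
    = ennreal \<theta> * (\<integral>\<^sup>+k. \<psi> (of_int k * h) * ennreal (p k) \<partial>count_space UNIV)"
proof -
  interpret N: real_distribution N by (rule N(1))
  have "(\<integral>\<^sup>+k. \<psi> (of_int k * h) * ennreal (p k) \<partial>count_space UNIV) = (\<integral>\<^sup>+y. \<psi> y \<partial>N)"
    by (subst nn_integral_lattice[OF N(2)]) (auto simp: p N.emeasure_eq_measure)
  also have "\<dots> = (\<integral>\<^sup>+\<omega>. ennreal (A \<omega> powr \<kappa> / \<theta>) * \<psi> (ln (A \<omega>)) \<partial>M)"
    by (subst tilted_law) (simp add: nn_integral_distr nn_integral_density)
  also have "ennreal \<theta> * \<dots> = (\<integral>\<^sup>+\<omega>. ennreal \<theta> * (ennreal (A \<omega> powr \<kappa> / \<theta>) * \<psi> (ln (A \<omega>))) \<partial>M)"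
    by (rule nn_integral_cmult[symmetric]) measurable
  also have "\<dots> = (\<integral>\<^sup>+\<omega>. ennreal (A \<omega> powr \<kappa>) * \<psi> (ln (A \<omega>)) \<partial>M)"
    using \<theta>_pos by (intro nn_integral_cong) (simp add: mult.assoc[symmetric] ennreal_mult[symmetric])
  finally show ?thesis ..
qed

lemma sum_int_nonneg_eq:
  assumes "(\<integral>\<^sup>+k. ennreal (f k) \<partial>count_space UNIV) \<le> ennreal c" "\<And>k. 0 \<le> f k"
  shows "summable_int f" "ennreal (sum_int f) = (\<integral>\<^sup>+k. ennreal (f k) \<partial>count_space UNIV)"
proof -
  show *: "summable_int f"
    by (rule integrableI_nonneg) (use assms in \<open>auto intro: le_less_trans\<close>)
  show "ennreal (sum_int f) = (\<integral>\<^sup>+k. ennreal (f k) \<partial>count_space UNIV)"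
    using nn_integral_eq_integral[OF *] assms(2) by simp
qed

text \<open>Undoing the tilt turns the second left-hand side into P{A \<noteq> 0}: the integrand is
  1 except at A = 0, where it is 0. This is the supersolution property of y^\<kappa>.\<close>

lemma tilted_sum_bound:
  shows "summable_int (\<lambda>k. p k * exp (- \<kappa> * (of_int k * h)))"
    and "\<theta> * sum_int (\<lambda>k. p k * exp (- \<kappa> * (of_int k * h))) \<le> 1"
proof -
  let ?f = "\<lambda>k. p k * exp (- \<kappa> * (of_int k * h))"
  have "ennreal \<theta> * (\<integral>\<^sup>+k. ennreal (?f k) \<partial>count_space UNIV)
      = ennreal \<theta> * (\<integral>\<^sup>+k. ennreal (exp (- \<kappa> * (of_int k * h))) * ennreal (p k) \<partial>count_space UNIV)"
    by (simp add: ennreal_mult p_nonneg mult.commute)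
  also have "\<dots> = (\<integral>\<^sup>+\<omega>. ennreal (A \<omega> powr \<kappa>) * ennreal (exp (- \<kappa> * ln (A \<omega>))) \<partial>M)"
    by (rule nn_integral_tilted[symmetric]) measurable
  also have "\<dots> \<le> (\<integral>\<^sup>+\<omega>. 1 \<partial>M)"
    by (intro nn_integral_mono)
       (auto simp: ennreal_mult[symmetric] powr_def exp_minus ennreal_1[symmetric] simp del: ennreal_1)
  also have "\<dots> = 1" by (simp add: emeasure_space_1)
  finally have 1: "ennreal \<theta> * (\<integral>\<^sup>+k. ennreal (?f k) \<partial>count_space UNIV) \<le> 1" .
  have "(\<integral>\<^sup>+k. ennreal (?f k) \<partial>count_space UNIV)
      = ennreal (1 / \<theta>) * (ennreal \<theta> * (\<integral>\<^sup>+k. ennreal (?f k) \<partial>count_space UNIV))"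
    using \<theta>_pos by (simp add: mult.assoc[symmetric] ennreal_mult[symmetric])
  also have "\<dots> \<le> ennreal (1 / \<theta>) * 1" by (intro mult_left_mono 1) simp
  finally have 2: "(\<integral>\<^sup>+k. ennreal (?f k) \<partial>count_space UNIV) \<le> ennreal (1 / \<theta>)" by simp
  note * = sum_int_nonneg_eq[OF 2 mult_nonneg_nonneg[OF p_nonneg exp_ge_zero]]
  show "summable_int ?f" by (rule *(1))
  have "ennreal (\<theta> * sum_int ?f) \<le> ennreal 1"
    using 1 *(2) \<theta>_pos by (simp add: ennreal_mult')
  then show "\<theta> * sum_int ?f \<le> 1" by (subst (asm) ennreal_le_iff) auto
qed

text \<open>By independence P{X > y / a} is integrated against the law of A, and the lattice turns a
  into exp (k h).\<close>

lemma tail_mult_eq: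
  assumes y: "y > 0"
  shows "tail_mult y = \<theta> * sum_int (\<lambda>k. p k * (exp (- \<kappa> * (of_int k * h)) * tail (y * exp (- (of_int k * h)))))"
    (is "_ = \<theta> * sum_int ?f")
proof -
  interpret PX: prob_space "distr M borel X" by (rule prob_space_distr) simp
  interpret PA: prob_space "distr M borel A" by (rule prob_space_distr) simp
  interpret P: pair_sigma_finite "distr M borel X" "distr M borel A" ..
  let ?S = "{z \<in> space (borel \<Otimes>\<^sub>M borel). snd z * fst z > y}"
  have S: "?S \<in> sets (borel \<Otimes>\<^sub>M borel)" by measurable
  have joint: "distr M borel X \<Otimes>\<^sub>M distr M borel A = distr M (borel \<Otimes>\<^sub>M borel) (\<lambda>\<omega>. (X \<omega>, A \<omega>))"
    using indep by (simp add: indep_var_distribution_eq)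
  have tail_em: "emeasure (distr M borel X) {x. x > t} = ennreal (tail t)" for t
    unfolding tail_def emeasure_eq_measure[symmetric]
    by (subst emeasure_distr) (auto intro!: arg_cong2[where f = emeasure])
  have "ennreal (tail_mult y) = emeasure (distr M (borel \<Otimes>\<^sub>M borel) (\<lambda>\<omega>. (X \<omega>, A \<omega>))) ?S"
    unfolding tail_mult_def emeasure_eq_measure[symmetric]
    by (subst emeasure_distr[OF _ S])
       (auto intro!: arg_cong2[where f = emeasure] simp: space_pair_measure)
  also have "\<dots> = (\<integral>\<^sup>+a. emeasure (distr M borel X) ((\<lambda>x. (x, a)) -` ?S) \<partial>distr M borel A)"
    unfolding joint[symmetric]
    by (rule P.emeasure_pair_measure_alt2) (use S in \<open>simp cong: sets_pair_measure_cong\<close>)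
  also have "\<dots> = (\<integral>\<^sup>+a. emeasure (distr M borel X) {x. a * x > y} \<partial>distr M borel A)"
    by (intro nn_integral_cong arg_cong2[where f = emeasure]) (auto simp: space_pair_measure)
  \<comment> \<open>For a > 0 the factor a^\<kappa> a^(-\<kappa>) = 1 is inserted to reach the
    tilted law. For a = 0 both sides vanish: y > 0 makes the event empty, and
    \<open>0 powr \<kappa> = 0\<close>.\<close>
  also have "\<dots> = (\<integral>\<^sup>+a. ennreal (a powr \<kappa>) * (ennreal (exp (- \<kappa> * ln a)) * ennreal (tail (y * exp (- ln a)))) \<partial>distr M borel A)"
  proof (rule nn_integral_cong_AE)
    have "AE a in distr M borel A. a \<ge> 0" using A_nonneg by (subst AE_distr_iff) auto
    then show "AE a in distr M borel A. emeasure (distr M borel X) {x. a * x > y}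
      = ennreal (a powr \<kappa>) * (ennreal (exp (- \<kappa> * ln a)) * ennreal (tail (y * exp (- ln a))))"
    proof eventually_elim
      case (elim a)
      show ?case
      proof (cases "a = 0")
        case True
        then show ?thesis using y by simp
      next
        case False
        with elim have a: "a > 0" by simp
        then have "{x. a * x > y} = {x. x > y * exp (- ln a)}"
          by (auto simp: exp_minus field_simps)
        moreover have "a powr \<kappa> * exp (- \<kappa> * ln a) = 1"
          using a by (simp add: powr_def exp_minus)
        ultimately show ?thesis
          by (simp add: tail_em mult.assoc[symmetric] ennreal_mult[symmetric])
      qed
    qed
  qed
  also have "\<dots> = (\<integral>\<^sup>+\<omega>. ennreal (A \<omega> powr \<kappa>) * (ennreal (exp (- \<kappa> * ln (A \<omega>))) * ennreal (tail (y * exp (- ln (A \<omega>))))) \<partial>M)"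
    by (rule nn_integral_distr) measurable
  also have "\<dots> = ennreal \<theta> * (\<integral>\<^sup>+k. (ennreal (exp (- \<kappa> * (of_int k * h))) * ennreal (tail (y * exp (- (of_int k * h))))) * ennreal (p k) \<partial>count_space UNIV)"
    by (rule nn_integral_tilted) measurable
  also have "\<dots> = ennreal \<theta> * (\<integral>\<^sup>+k. ennreal (?f k) \<partial>count_space UNIV)"
    by (simp add: ennreal_mult p_nonneg tail_bounds mult_ac)
  also have "\<dots> = ennreal \<theta> * ennreal (sum_int ?f)"
  proof (subst nn_integral_eq_integral)
    show "summable_int ?f"
    proof (rule Bochner_Integration.integrable_bound[OF tilted_sum_bound(1)])
      show "AE k in count_space UNIV. norm (?f k) \<le> norm (p k * exp (- \<kappa> * (of_int k * h)))"
        by (auto simp: abs_mult p_nonneg tail_bounds mult_left_le intro!: mult_left_mono)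
    qed simp
  qed (auto simp: p_nonneg tail_bounds)
  also have "\<dots> = ennreal (\<theta> * sum_int ?f)" using \<theta>_pos by (simp add: ennreal_mult')
  finally show ?thesis
    using \<theta>_pos
    by (subst (asm) ennreal_inj)
       (auto simp: tail_bounds p_nonneg intro!: mult_nonneg_nonneg integral_nonneg_AE)
qed

text \<open>The renewal argument on one geometric progression of scales; \<open>fin\<close> is what
  \<open>exists_summable_scaling\<close> provides.\<close>

lemma scaled_tail_limit:
  assumes x: "x > 0"
    and fin: "(\<Sum>n. ennreal (exp (real n * h)) * ennreal ((x * exp (real n * h)) powr (\<kappa> + \<delta> - 1)
        * \<bar>tail (x * exp (real n * h)) - tail_mult (x * exp (real n * h))\<bar>)) < \<infinity>"
  shows "\<exists>l. ((\<lambda>n. (x * exp (of_int n * h)) powr \<kappa> * tail (x * exp (of_int n * h)) / p n) \<longlongrightarrow> l) at_top"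
proof -
  define Y where "Y n = x * exp (of_int n * h)" for n :: int
  define g where "g n = Y n powr \<kappa> * (tail (Y n) - tail_mult (Y n))" for n
  \<comment> \<open>A shift multiplies \<open>w\<close> by a constant, so \<open>w\<close> is an
    eigenfunction of convolution with \<open>p\<close>.\<close>
  define w where "w n = Y n powr \<kappa>" for n
  define G where "G n = Y n powr \<kappa> * tail (Y n)" for n
  have Y_pos: "Y n > 0" for n using x by (simp add: Y_def)
  have Y_shift: "Y (n - k) = Y n * exp (- (of_int k * h))" for n k
    by (simp add: Y_def mult.assoc exp_add[symmetric] algebra_simps)
  have w_shift: "w (n - k) = w n * exp (- \<kappa> * (of_int k * h))" for n k
    by (simp add: w_def Y_shift powr_mult exp_powr_real mult_ac)
  have w_pos: "w n > 0" for n using Y_pos[of n] by (simp add: w_def)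
  have g_le_w: "\<bar>g n\<bar> \<le> w n" for n
  proof -
    have "\<bar>tail (Y n) - tail_mult (Y n)\<bar> \<le> 1" using tail_bounds[of "Y n"] by linarith
    then have "Y n powr \<kappa> * \<bar>tail (Y n) - tail_mult (Y n)\<bar> \<le> Y n powr \<kappa> * 1"
      by (intro mult_left_mono) auto
    then show ?thesis by (simp add: g_def w_def abs_mult)
  qed
  \<comment> \<open>Up to x^(1 - \<delta>), the Jacobian e^(nh) turns the weight Y^(\<kappa> +
    \<delta> - 1) into e^(\<delta>hn) Y^\<kappa>.\<close>
  have weighted: "summable (\<lambda>n. exp (\<delta> * h * real n) * \<bar>g (int n)\<bar>)"
  proof -
    let ?f = "\<lambda>n. exp (real n * h) * (Y (int n) powr (\<kappa> + \<delta> - 1) * \<bar>tail (Y (int n)) - tail_mult (Y (int n))\<bar>)"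
    have "summable ?f"
      by (rule summable_suminf_not_top)
         (use fin in \<open>auto simp: Y_def ennreal_mult\<close>)
    then have "summable (\<lambda>n. x powr (1 - \<delta>) * ?f n)" by (rule summable_mult)
    moreover have "x powr (1 - \<delta>) * ?f n = exp (\<delta> * h * real n) * \<bar>g (int n)\<bar>" for n
    proof -
      have "x powr (1 - \<delta>) * (exp (real n * h) * Y (int n) powr (\<kappa> + \<delta> - 1))
          = exp (\<delta> * h * real n) * Y (int n) powr \<kappa>"
        using x by (simp add: Y_def powr_def ln_mult exp_add[symmetric] algebra_simps)
      then show ?thesis by (simp add: g_def abs_mult mult_ac)
    qed
    ultimately show ?thesis by simp
  qed
  have summ_g: "summable_int g"
  proof (rule summable_int_halves)
    show "summable (\<lambda>n. \<bar>g (int n)\<bar>)"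
    proof (rule summable_comparison_test_ev[OF _ weighted])
      have "1 * \<bar>g (int n)\<bar> \<le> exp (\<delta> * h * real n) * \<bar>g (int n)\<bar>" for n
        using \<delta>_pos h_pos by (intro mult_right_mono) auto
      then show "\<forall>\<^sub>F n in sequentially. norm \<bar>g (int n)\<bar> \<le> exp (\<delta> * h * real n) * \<bar>g (int n)\<bar>"
        by simp
    qed
    \<comment> \<open>\<open>fin\<close> covers nonnegative indices only; to the left the trivial
      bound by \<open>w\<close> is already geometric.\<close>
    have "summable (\<lambda>n. w 0 * exp (- \<kappa> * h) ^ n)"
      using \<kappa>_pos h_pos by (intro summable_mult summable_geometric) simp
    then show "summable (\<lambda>n. \<bar>g (- int n)\<bar>)"
    proof (rule summable_comparison_test_ev[rotated])
      have "\<bar>g (- int n)\<bar> \<le> w 0 * exp (- \<kappa> * h) ^ n" for n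
        using g_le_w[of "- int n"] w_shift[of 0 "int n"]
        by (simp add: exp_of_nat_mult[symmetric] mult_ac)
      then show "\<forall>\<^sub>F n in sequentially. norm \<bar>g (- int n)\<bar> \<le> w 0 * exp (- \<kappa> * h) ^ n"
        by simp
    qed
  qed
  have lim_g: "((\<lambda>n. g n / p n) \<longlongrightarrow> 0) at_top"
  proof -
    have "\<delta> * h > 0" using \<delta>_pos h_pos by simp
    then obtain b where b: "b > 0" "\<forall>\<^sub>F n in sequentially. b \<le> p (int n) * exp (\<delta> * h * real n)"
      using exp_lower_bound by blast
    have "(\<lambda>n. exp (\<delta> * h * real n) * \<bar>g (int n)\<bar> / b) \<longlonglongrightarrow> 0 / b"
      by (intro tendsto_divide tendsto_const summable_LIMSEQ_zero[OF weighted]) (use b in simp)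
    then have "(\<lambda>n. exp (\<delta> * h * real n) * \<bar>g (int n)\<bar> / b) \<longlonglongrightarrow> 0" by simp
    moreover have "\<forall>\<^sub>F n in sequentially. norm (g (int n) / p (int n)) \<le> exp (\<delta> * h * real n) * \<bar>g (int n)\<bar> / b"
      using b(2) p_pos[unfolded eventually_int_at_top_iff]
    proof eventually_elim
      case (elim n)
      have "b * \<bar>g (int n)\<bar> \<le> p (int n) * exp (\<delta> * h * real n) * \<bar>g (int n)\<bar>"
        using elim by (intro mult_right_mono) auto
      then show ?case using elim b by (simp add: abs_divide field_simps)
    qed
    ultimately have "(\<lambda>n. g (int n) / p (int n)) \<longlonglongrightarrow> 0" by (rule Lim_null_comparison[rotated])
    then show ?thesis by (simp add: tendsto_int_at_top_iff)
  qed
  have w_int: "p k * w (n - k) = w n * (p k * exp (- \<kappa> * (of_int k * h)))" for n k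
    by (simp add: w_shift)
  have "\<exists>l. ((\<lambda>n. G n / p n) \<longlongrightarrow> l) at_top"
  proof (rule renewal_equation_limit[OF summ_g \<theta>_pos \<theta>_less_1 lim_g _ _ w_pos])
    show "0 \<le> G n" for n by (simp add: G_def tail_bounds)
    show "G n = g n + renewal_step \<theta> G n" for n
    proof -
      have "conv p G n = sum_int (\<lambda>k. w n * (p k * (exp (- \<kappa> * (of_int k * h)) * tail (Y n * exp (- (of_int k * h))))))"
        unfolding conv_def G_def w_def[symmetric] w_shift unfolding Y_shift by (simp add: mult_ac)
      then have "renewal_step \<theta> G n = w n * tail_mult (Y n)"
        by (simp add: renewal_step_def tail_mult_eq[OF Y_pos])
      then show ?thesis by (simp add: G_def g_def w_def algebra_simps)
    qed
    show "summable_int (\<lambda>k. p k * w (n - k))" for n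
      unfolding w_int by (intro integrable_mult_right tilted_sum_bound(1))
    show "renewal_step \<theta> w n \<le> w n" for n
    proof -
      have "renewal_step \<theta> w n = w n * (\<theta> * sum_int (\<lambda>k. p k * exp (- \<kappa> * (of_int k * h))))"
        unfolding renewal_step_def conv_def w_int by simp
      also have "\<dots> \<le> w n * 1"
        using w_pos[of n] by (intro mult_left_mono tilted_sum_bound(2)) auto
      finally show ?thesis by simp
    qed
    show "\<exists>B. \<forall>n. G n \<le> \<epsilon> * w n + B" if "\<epsilon> > 0" for \<epsilon>
    proof -
      have "\<forall>\<^sub>F y in at_top. tail y < \<epsilon>" using tail_tendsto_0 that by (rule order_tendstoD)
      then obtain y0 where y0: "\<And>y. y \<ge> y0 \<Longrightarrow> tail y < \<epsilon>"
        unfolding eventually_at_top_linorder by blast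
      \<comment> \<open>Beyond \<open>y0\<close> the tail is below \<epsilon>; before it
        \<open>w\<close> is bounded. The maximum with 0 is taken because \<open>y0\<close> may be
        negative.\<close>
      have "G n \<le> \<epsilon> * w n + max y0 0 powr \<kappa>" for n
      proof (cases "Y n \<ge> y0")
        case True
        then have "w n * tail (Y n) \<le> w n * \<epsilon>"
          using y0[of "Y n"] w_pos[of n] by (intro mult_left_mono) auto
        then show ?thesis by (simp add: G_def w_def mult.commute add_increasing2)
      next
        case False
        have "w n * tail (Y n) \<le> w n * 1" using w_pos[of n] tail_bounds by (intro mult_left_mono) auto
        also have "w n \<le> max y0 0 powr \<kappa>"
          unfolding w_def using False Y_pos[of n] \<kappa>_pos by (intro powr_mono2) auto
        finally show ?thesis using w_pos[of n] that by (simp add: G_def w_def add_increasing)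
      qed
      then show ?thesis by blast
    qed
  qed
  then show ?thesis by (simp add: G_def Y_def)
qed

lemma tail_log_periodic_limit:
  "\<exists>q \<in> log_periodic_class \<kappa> h. \<forall>x \<in> continuity_points q.
     (\<lambda>n::nat. inverse (p (int n)) * x powr \<kappa> * exp (\<kappa> * real n * h) * tail (x * exp (real n * h))) \<longlonglongrightarrow> q x"
proof -
  \<comment> \<open>x^\<kappa> is left out because \<open>H\<close> has to be nonincreasing in x;
    the conclusion of \<open>log_periodic_limit\<close> restores it.\<close>
  define H where "H n x = inverse (p (int n)) * exp (\<kappa> * real n * h) * tail (x * exp (real n * h))" for n x
  define r where "r n = p (int n + 1) / p (int n)" for n
  have "\<exists>q \<in> log_periodic_class \<kappa> h. \<forall>x \<in> continuity_points q. (\<lambda>n. x powr \<kappa> * H n x) \<longlonglongrightarrow> q x"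
  proof (rule log_periodic_limit[OF h_pos])
    show "\<forall>\<^sub>F n in sequentially. \<forall>x>0. 0 \<le> H n x"
      by (simp add: H_def p_nonneg tail_bounds)
    show "\<forall>\<^sub>F n in sequentially. \<forall>x y. 0 < x \<longrightarrow> x \<le> y \<longrightarrow> H n y \<le> H n x"
      unfolding H_def
      by (intro always_eventually allI impI mult_left_mono tail_antimono mult_right_mono) (auto simp: p_nonneg)
    show "r \<longlonglongrightarrow> 1"
      using p_ratio unfolding tendsto_int_at_top_iff r_def .
    \<comment> \<open>The shift identity replaces 1 / p n by r n / p (n + 1), which requires p (n +
      1) to be nonzero.\<close>
    have "\<forall>\<^sub>F n in at_top. p (n - (- 1)) > 0"
      using p_pos filterlim_minus_const_int by (rule eventually_compose_filterlim)
    then have "\<forall>\<^sub>F n in sequentially. p (int n + 1) > 0"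
      unfolding eventually_int_at_top_iff by simp
    then show "\<forall>\<^sub>F n in sequentially. H n (x * exp h) = exp (- \<kappa> * h) * (r n * H (Suc n) x)" for x
    proof eventually_elim
      case (elim n)
      have 1: "x * exp h * exp (real n * h) = x * exp (real (Suc n) * h)"
        by (simp add: exp_add[symmetric] algebra_simps)
      have 2: "exp (\<kappa> * real n * h) = exp (- \<kappa> * h) * exp (\<kappa> * real (Suc n) * h)"
        by (simp add: exp_add[symmetric] algebra_simps)
      have 3: "p (int (Suc n)) = p (int n + 1)" by (simp add: add.commute)
      have "H n (x * exp h) = inverse (p (int n)) * (exp (- \<kappa> * h) * exp (\<kappa> * real (Suc n) * h))
          * tail (x * exp (real (Suc n) * h))"
        unfolding H_def by (simp only: 1 2)
      also have "\<dots> = exp (- \<kappa> * h) * (r n * H (Suc n) x)"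
        unfolding H_def r_def 3 using elim by (simp add: divide_inverse del: of_nat_Suc)
      finally show ?case .
    qed
    show "\<exists>x. a < x \<and> x < b \<and> convergent (\<lambda>n. H n x)" if ab: "0 < a" "a < b" for a b
    proof -
      let ?\<phi> = "\<lambda>y. ennreal (y powr (\<kappa> + \<delta> - 1) * \<bar>tail y - tail_mult y\<bar>)"
      have "(\<integral>\<^sup>+y. indicator {0<..} y * ?\<phi> y \<partial>lborel)
          = (\<integral>\<^sup>+y. norm (indicator {0<..} y *\<^sub>R (y powr (\<kappa> + \<delta> - 1) * \<bar>tail y - tail_mult y\<bar>)) \<partial>lborel)"
        by (intro nn_integral_cong) (auto simp: indicator_def abs_mult)
      also have "\<dots> < \<infinity>"
        using integrable_diff unfolding set_integrable_def integrable_iff_bounded tail_def tail_mult_def by blast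
      finally have "\<exists>x. a < x \<and> x < b \<and> (\<Sum>n. ennreal (exp (real n * h)) * ?\<phi> (x * exp (real n * h))) < \<infinity>"
        by (intro exists_summable_scaling ab h_pos) measurable
      then obtain x where x: "a < x" "x < b"
        "(\<Sum>n. ennreal (exp (real n * h)) * ?\<phi> (x * exp (real n * h))) < \<infinity>" by blast
      have x0: "x > 0" using x ab by simp
      obtain l where "((\<lambda>n. (x * exp (of_int n * h)) powr \<kappa> * tail (x * exp (of_int n * h)) / p n) \<longlongrightarrow> l) at_top"
        using scaled_tail_limit[OF x0 x(3)] by blast
      \<comment> \<open>\<open>scaled_tail_limit\<close> is normalized by (x e^(nh))^\<kappa> and
        \<open>H\<close> by e^(\<kappa>nh); x^(-\<kappa>) converts one into the other.\<close>
      from tendsto_mult[OF tendsto_const this[unfolded tendsto_int_at_top_iff], of "x powr (- \<kappa>)"]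
      have "(\<lambda>n. x powr (- \<kappa>) * ((x * exp (real n * h)) powr \<kappa> * tail (x * exp (real n * h)) / p (int n)))
        \<longlonglongrightarrow> x powr (- \<kappa>) * l" by simp
      moreover have "x powr (- \<kappa>) * ((x * exp (real n * h)) powr \<kappa> * tail (x * exp (real n * h)) / p (int n)) = H n x" for n
      proof -
        have "x powr (- \<kappa>) * (x * exp (real n * h)) powr \<kappa> = exp (\<kappa> * real n * h)"
          using x0 by (simp add: powr_def ln_mult exp_add[symmetric] algebra_simps)
        then show ?thesis by (simp add: H_def divide_inverse mult_ac)
      qed
      ultimately show ?thesis using x by (auto simp: convergent_def)
    qed
  qed
  then show ?thesis by (simp add: H_def mult_ac)
qed

end

theorem theorem7:
  fixes M :: "'a measure" and A X :: "'a \<Rightarrow> real"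
    and \<kappa> h \<theta> \<delta> :: real and p :: "int \<Rightarrow> real"
  assumes "prob_space M"
    and "\<kappa> > 0" and "h > 0"
    and "A \<in> borel_measurable M" and "AE \<omega> in M. A \<omega> \<ge> 0"
    and "integrable M (\<lambda>\<omega>. A \<omega> powr \<kappa>)" and "(LINT \<omega>|M. A \<omega> powr \<kappa>) = \<theta>"
    and "0 < \<theta>" and "\<theta> < 1"
    and "arithmetic_with_span (log_dist_nonzero M A) h"
    and p_def: "p = (\<lambda>n. lattice_mass h (tilted_df M A \<kappa>) n)"
    and "tilted_df M A \<kappa> \<in> lattice_subexponential h"
    and "(\<lambda>n::nat. SUP k\<in>{int n..}. p k) \<in> O(\<lambda>n. p (int n))"
    and "X \<in> borel_measurable M"
    and "prob_space.indep_var M borel X borel A"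
    and "\<delta> > 0"
    and "set_integrable lborel {0<..}
           (\<lambda>y. y powr (\<kappa> + \<delta> - 1) *
              \<bar>measure M {\<omega> \<in> space M. X \<omega> > y} - measure M {\<omega> \<in> space M. A \<omega> * X \<omega> > y}\<bar>)"
  shows "\<exists>q \<in> log_periodic_class \<kappa> h. \<forall>x \<in> continuity_points q.
           (\<lambda>n::nat. inverse (p (int n)) * x powr \<kappa> * exp (\<kappa> * real n * h) *
              measure M {\<omega> \<in> space M. X \<omega> > x * exp (real n * h)}) \<longlonglongrightarrow> q x"
proof -
  obtain N where N: "real_distribution N" "concentrated_on_lattice N h" "tilted_df M A \<kappa> = cdf N"
    and lim: "(\<lambda>n::nat. lattice_mass h (cdf N) (int n + 1) / lattice_mass h (cdf N) (int n)) \<longlonglongrightarrow> 1"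
      "(\<lambda>n::nat. lattice_mass h (df_convolution (cdf N) (cdf N)) (int n) / lattice_mass h (cdf N) (int n)) \<longlonglongrightarrow> 2"
    using assms(12) by (auto simp: lattice_subexponential_def arithmetic_with_span_def)
  interpret N: real_distribution N by (rule N(1))
  have p: "p = lattice_mass h (cdf N)" by (simp add: p_def N(3))
  have "implicit_renewal M A X \<kappa> h \<theta> \<delta> N p"
  proof (intro implicit_renewal.intro implicit_renewal_axioms.intro)
    show "local_subexponential p"
      unfolding p using assms(13) N(1,2) lim
      by (intro local_subexponential_lattice_mass) (auto simp: p)
    show "p k = measure N {of_int k * h}" for k
      unfolding p by (rule N.lattice_mass_cdf)
  qed (use assms N in auto)
  then interpret implicit_renewal M A X \<kappa> h \<theta> \<delta> N p .
  show ?thesis using tail_log_periodic_limit unfolding tail_def .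
qed

end
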